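(* For every positive integer $k$ and every $\epsilon>0$ there is a one-sided-error, adaptive, distribution-free testing algorithm for the class of $k$-juntas over $\{0,1\}^n$ (for every $n$) with distance parameter $\epsilon$ whose query complexity is $\tilde{O}(k^2)/\epsilon$. In particular the query complexity is independent of $n$.
   Context: A Boolean function $f:\{0,1\}^n\to\{0,1\}$ is a $k$-junta if there are indices $i_1<\dots<i_k$ in $[n]$ and $h:\{0,1\}^k\to\{0,1\}$ with $f(x)=h(x_{i_1},\dots,x_{i_k})$ for all $x$. For a distribution $\mathcal{D}$ on $\{0,1\}^n$, $\mathrm{dist}_{\mathcal{D}}(f,g)=\Pr_{x\sim\mathcal{D}}[f(x)\neq g(x)]$, and $f$ is $\epsilon$-far from $k$-juntas with respect to $\mathcal{D}$ if $\mathrm{dist}_{\mathcal{D}}(f,g)\ge\epsilon$ for every $k$-junta $g$ on $n$ variables. In the distribution-free testing model the algorithm is given $\epsilon$ and oracle access to an unknown pair $(f,\mathcal{D})$: it may query $f(x)$ for any $x$ of its choice (black-box queries), and it may request samples, each returning $(x,f(x))$ with $x\sim\mathcal{D}$ drawn independently. A distribution-free tester for $k$-juntas must accept with probability at least $2/3$ if $f$ is a $k$-junta and reject with probability at least $2/3$ if $f$ is $\epsilon$-far from $k$-juntas with respect to $\mathcal{D}$, for every $f$ and every $\mathcal{D}$; it is one-sided if it always accepts when $f$ is a $k$-junta. Its query complexity is the worst case (over all $f,\mathcal{D}$) of the number of black-box queries plus the number of samples. Adaptive means each query may depend on answers to all previous queries and samples. *)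

theory Defs
  imports "HOL-Probability.Probability" "HOL-Library.Landau_Symbols"
begin

definition cube :: "nat \<Rightarrow> bool list set" where
  "cube n = {x. length x = n}"

(* Boolean functions on n variables are represented by arbitrary functions on bool lists; only
   their values on cube n are relevant.  Coordinates are numbered from 0.
   The k indices are required to be distinct elements of {..<n}, so there is no k-junta if k > n. *)
definition junta :: "nat \<Rightarrow> nat \<Rightarrow> (bool list \<Rightarrow> bool) \<Rightarrow> bool" where
  "junta n k f \<longleftrightarrow>
     (\<exists>is h. length is = k \<and> sorted_wrt (<) is \<and> set is \<subseteq> {..<n} \<and>
        (\<forall>x \<in> cube n. f x = h (map (\<lambda>i. x ! i) is)))"

definition distance :: "bool list pmf \<Rightarrow> (bool list \<Rightarrow> bool) \<Rightarrow> (bool list \<Rightarrow> bool) \<Rightarrow> real" where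
  "distance D f g = measure_pmf.prob D {x. f x \<noteq> g x}"

definition far_from_juntas ::
  "nat \<Rightarrow> nat \<Rightarrow> real \<Rightarrow> bool list pmf \<Rightarrow> (bool list \<Rightarrow> bool) \<Rightarrow> bool" where
  "far_from_juntas n k \<epsilon> D f \<longleftrightarrow> (\<forall>g. junta n k g \<longrightarrow> distance D f g \<ge> \<epsilon>)"

(* Adaptive randomized oracle algorithms.  The next action may depend on all earlier query
   answers, labelled samples and internal random choices.  Coin p draws from a distribution p of
   the algorithm's choice, which is fixed independently of the unknown pair (f, D). *)
datatype oracle_alg =
    Verdict bool
  | Query "bool list" "bool \<Rightarrow> oracle_alg"
  | Sample "bool list \<times> bool \<Rightarrow> oracle_alg"
  | Coin "nat pmf" "nat \<Rightarrow> oracle_alg"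

primrec queries_within :: "bool list set \<Rightarrow> oracle_alg \<Rightarrow> bool" where
  "queries_within X (Verdict b) \<longleftrightarrow> True"
| "queries_within X (Query x c) \<longleftrightarrow> x \<in> X \<and> (\<forall>b. queries_within X (c b))"
| "queries_within X (Sample c) \<longleftrightarrow> (\<forall>s. queries_within X (c s))"
| "queries_within X (Coin p c) \<longleftrightarrow> (\<forall>r. queries_within X (c r))"

(* Joint distribution of the verdict (True = accept) and the number of black-box queries plus
   samples; internal coins are free. *)
primrec run ::
  "(bool list \<Rightarrow> bool) \<Rightarrow> bool list pmf \<Rightarrow> oracle_alg \<Rightarrow> (bool \<times> nat) pmf" where
  "run f D (Verdict b) = return_pmf (b, 0)"
| "run f D (Query x c) = map_pmf (apsnd Suc) (run f D (c (f x)))"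
| "run f D (Sample c) = map_pmf (apsnd Suc) (bind_pmf D (\<lambda>x. run f D (c (x, f x))))"
| "run f D (Coin p c) = bind_pmf p (\<lambda>r. run f D (c r))"

definition prob_accept :: "(bool list \<Rightarrow> bool) \<Rightarrow> bool list pmf \<Rightarrow> oracle_alg \<Rightarrow> real" where
  "prob_accept f D A = measure_pmf.prob (run f D A) {r. fst r}"

definition prob_reject :: "(bool list \<Rightarrow> bool) \<Rightarrow> bool list pmf \<Rightarrow> oracle_alg \<Rightarrow> real" where
  "prob_reject f D A = measure_pmf.prob (run f D A) {r. \<not> fst r}"

(* Worst case over all f, all D and all outcomes of the samples and the internal randomness. *)
definition query_complexity :: "nat \<Rightarrow> oracle_alg \<Rightarrow> enat" where
  "query_complexity n A =
     (SUP (f, D) \<in> {(f, D). set_pmf D \<subseteq> cube n}. SUP r \<in> set_pmf (run f D A). enat (snd r))"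

definition distribution_free_junta_tester :: "nat \<Rightarrow> nat \<Rightarrow> real \<Rightarrow> oracle_alg \<Rightarrow> bool" where
  "distribution_free_junta_tester n k \<epsilon> A \<longleftrightarrow>
     queries_within (cube n) A \<and>
     (\<forall>f D. set_pmf D \<subseteq> cube n \<longrightarrow>
        (junta n k f \<longrightarrow> prob_accept f D A \<ge> 2 / 3) \<and>
        (far_from_juntas n k \<epsilon> D f \<longrightarrow> prob_reject f D A \<ge> 2 / 3))"

definition one_sided :: "nat \<Rightarrow> nat \<Rightarrow> oracle_alg \<Rightarrow> bool" where
  "one_sided n k A \<longleftrightarrow>
     (\<forall>f D. set_pmf D \<subseteq> cube n \<longrightarrow> junta n k f \<longrightarrow> prob_accept f D A = 1)"

definition soft_O :: "(nat \<Rightarrow> real) \<Rightarrow> (nat \<Rightarrow> real) set" where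
  "soft_O g = (\<Union>c::nat. O(\<lambda>m. g m * ln (g m) ^ c))"

end

theory Submission
  imports Defs "HOL-Real_Asymp.Real_Asymp"
begin

text \<open>
  The tester keeps the transcript of all answers together with disjoint sets of variables
  (\<open>blocks\<close>), each of which the transcript shows to be relevant: it contains two points with
  different values that differ exactly on the block. Disjoint relevant blocks need distinct relevant
  variables, so rejecting on \<open>k + 1\<close> blocks never rejects a junta.

  One round costs \<open>O(k log k)\<close> queries and finds a further block with probability \<open>\<Omega>(\<epsilon>)\<close> when \<open>f\<close> is
  far from juntas, so \<open>O(k / \<epsilon>)\<close> rounds suffice. A block with witness \<open>w\<close> gives a function \<open>F\<close> on sets
  of variables, telling whether flipping the part of the block in the set changes \<open>f w\<close>. Query \<open>F\<close> on the
  Boolean algebra generated by three random sets. Unless two disjoint members of the algebra are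
  relevant, which splits the block, \<open>F\<close> looks like a dictator on this algebra. If that happens with
  probability close to 1, then linearity testing and self-correction show that \<open>F\<close> is close to a
  dictator \<open>\<tau>\<close>. By voting, \<open>O(log k)\<close> random sets then tell for all blocks at once on which side of
  a random set \<open>S\<close> the variable \<open>\<tau>\<close> lies, with an error that is small for every \<open>S\<close>. So a sample \<open>x\<close> can be
  rerandomised on all variables except the unknown dictators. As \<open>f\<close> is far from juntas on the
  dictators, this changes \<open>f x\<close> with probability at least \<open>\<epsilon> / 2\<close>, and a walk from \<open>x\<close> to the new
  point that flips block by block finds a relevant set off the blocks or splits a block.
\<close>

subsection \<open>Averages over random sets\<close>

definition set_avg :: "nat \<Rightarrow> (nat set \<Rightarrow> real) \<Rightarrow> real" where
  "set_avg n \<phi> = (\<Sum>S\<in>Pow {..<n}. \<phi> S) / 2 ^ n"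

lemma of_bool_le_iff: "(of_bool P \<le> (of_bool Q :: real)) \<longleftrightarrow> (P \<longrightarrow> Q)"
  by simp

lemma set_avg_cong: "(\<And>S. S \<subseteq> {..<n} \<Longrightarrow> \<phi> S = \<psi> S) \<Longrightarrow> set_avg n \<phi> = set_avg n \<psi>"
  unfolding set_avg_def by (intro arg_cong2[where f = "(/)"] sum.cong) auto

lemma set_avg_mono: "(\<And>S. S \<subseteq> {..<n} \<Longrightarrow> \<phi> S \<le> \<psi> S) \<Longrightarrow> set_avg n \<phi> \<le> set_avg n \<psi>"
  unfolding set_avg_def by (intro divide_right_mono sum_mono) auto

lemma set_avg_const [simp]: "set_avg n (\<lambda>S. c) = c"
  by (simp add: set_avg_def card_Pow)

lemma set_avg_add: "set_avg n (\<lambda>S. \<phi> S + \<psi> S) = set_avg n \<phi> + set_avg n \<psi>"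
  by (simp add: set_avg_def sum.distrib add_divide_distrib)

lemma set_avg_diff: "set_avg n (\<lambda>S. \<phi> S - \<psi> S) = set_avg n \<phi> - set_avg n \<psi>"
  by (simp add: set_avg_def sum_subtractf diff_divide_distrib)

lemma set_avg_cmult: "set_avg n (\<lambda>S. c * \<phi> S) = c * set_avg n \<phi>"
  by (simp add: set_avg_def sum_distrib_left)

lemma set_avg_multc: "set_avg n (\<lambda>S. \<phi> S * c) = set_avg n \<phi> * c"
  by (simp add: set_avg_def sum_distrib_right)

lemma set_avg_sum: "set_avg n (\<lambda>S. \<Sum>i\<in>I. \<phi> i S) = (\<Sum>i\<in>I. set_avg n (\<phi> i))"
  unfolding set_avg_def sum_divide_distrib by (rule sum.swap)

lemma set_avg_swap: "set_avg n (\<lambda>S. set_avg n (\<phi> S)) = set_avg n (\<lambda>T. set_avg n (\<lambda>S. \<phi> S T))"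
  unfolding set_avg_def by (simp add: sum_divide_distrib[symmetric]) (subst sum.swap, rule refl)

lemma set_avg_nonneg: "(\<And>S. S \<subseteq> {..<n} \<Longrightarrow> 0 \<le> \<phi> S) \<Longrightarrow> 0 \<le> set_avg n \<phi>"
  using set_avg_mono[of n "\<lambda>_. 0" \<phi>] by simp

lemma set_avg_le_const: "(\<And>S. S \<subseteq> {..<n} \<Longrightarrow> \<phi> S \<le> c) \<Longrightarrow> set_avg n \<phi> \<le> c"
  using set_avg_mono[of n \<phi> "\<lambda>_. c"] by simp

lemma set_avg_ge_const: "(\<And>S. S \<subseteq> {..<n} \<Longrightarrow> c \<le> \<phi> S) \<Longrightarrow> c \<le> set_avg n \<phi>"
  using set_avg_mono[of n "\<lambda>_. c" \<phi>] by simp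

text \<open>Adding the fixed set \<open>A\<close> is an involution on the subsets of
  \<open>{..<n}\<close>: sets act as vectors over the field with two elements, with
  \<open>sym_diff\<close> as addition.\<close>

lemma set_avg_shift:
  assumes "A \<subseteq> {..<n}"
  shows "set_avg n (\<lambda>S. \<phi> (sym_diff S A)) = set_avg n \<phi>"
proof -
  have "bij_betw (\<lambda>S. sym_diff S A) (Pow {..<n}) (Pow {..<n})"
    by (rule bij_betw_byWitness[where f' = "\<lambda>S. sym_diff S A"]) (use assms in auto)
  then show ?thesis
    unfolding set_avg_def by (subst sum.reindex_bij_betw) auto
qed

lemma set_avg_shift_left:
  assumes "A \<subseteq> {..<n}"
  shows "set_avg n (\<lambda>S. \<phi> (sym_diff A S)) = set_avg n \<phi>"
  using set_avg_shift[OF assms, of \<phi>] by (simp add: Un_commute)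

text \<open>Translating \<open>J\<close> by \<open>S\<close> turns the mixture into \<open>S\<close>
  shifted by \<open>J \<inter> I\<close>, which no longer depends on \<open>S\<close>. This allows
  the trace of a random set on \<open>I\<close> to be resampled independently.\<close>

lemma set_avg_mix:
  "set_avg n (\<lambda>S. set_avg n (\<lambda>J. \<psi> ((S - I) \<union> (J \<inter> I)))) = set_avg n \<psi>"
proof -
  have eq: "(S - I) \<union> (J \<inter> I) = sym_diff S (sym_diff S J \<inter> I)" for S J :: "nat set"
    by auto
  have "set_avg n (\<lambda>S. set_avg n (\<lambda>J. \<psi> ((S - I) \<union> (J \<inter> I))))
      = set_avg n (\<lambda>S. set_avg n (\<lambda>J. \<psi> (sym_diff S (J \<inter> I))))"
    unfolding eq
    by (intro set_avg_cong set_avg_shift_left[where \<phi> = "\<lambda>J. \<psi> (sym_diff S (J \<inter> I))" for S])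
  also have "\<dots> = set_avg n (\<lambda>J. set_avg n (\<lambda>S. \<psi> (sym_diff S (J \<inter> I))))"
    by (rule set_avg_swap)
  also have "\<dots> = set_avg n (\<lambda>J. set_avg n \<psi>)"
    by (intro set_avg_cong set_avg_shift) auto
  finally show ?thesis
    by simp
qed

lemma set_avg_of_bool_not: "set_avg n (\<lambda>S. of_bool (\<not> Q S)) = 1 - set_avg n (\<lambda>S. of_bool (Q S))"
  using set_avg_diff[of n "\<lambda>_. 1" "\<lambda>S. of_bool (Q S)"] by (simp add: of_bool_not_iff)

lemma prob_random_set:
  "measure_pmf.prob (pmf_of_set (Pow {..<n})) {S. Q S} = set_avg n (\<lambda>S. of_bool (Q S))"
  by (subst measure_pmf_of_set) (auto simp: set_avg_def card_Pow Int_def)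

lemma expectation_random_set:
  "measure_pmf.expectation (pmf_of_set (Pow {..<n})) \<phi> = set_avg n \<phi>"
  by (subst integral_pmf_of_set) (auto simp: set_avg_def card_Pow)

subsection \<open>Testing dictators\<close>

text \<open>The first clause is the linearity test, the second excludes the zero function, the next
  two compare \<open>F\<close> on \<open>S \<inter> T\<close> and \<open>S - T\<close> with its
  self-corrected value at the random shift \<open>R\<close>, and the last excludes parities of two
  or more variables.\<close>

definition dictator_like ::
    "nat \<Rightarrow> (nat set \<Rightarrow> bool) \<Rightarrow> nat set \<Rightarrow> nat set \<Rightarrow> nat set \<Rightarrow> bool" where
  "dictator_like n F S T R \<longleftrightarrow>
     (F (sym_diff S T) \<longleftrightarrow> F S \<noteq> F T) \<and>
     (F (sym_diff S {..<n}) \<longleftrightarrow> \<not> F S) \<and>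
     (F (sym_diff R (S \<inter> T)) \<longleftrightarrow> F R \<noteq> F (S \<inter> T)) \<and>
     (F (sym_diff R (S - T)) \<longleftrightarrow> F R \<noteq> F (S - T)) \<and>
     \<not> (F (S \<inter> T) \<and> F (S - T))"

text \<open>The majority \<open>g A\<close> of \<open>F X \<noteq> F (sym_diff X A)\<close> over
  \<open>X\<close> turns out to be additive, hence a parity; the complement clause makes it nonzero
  and the disjointness clause leaves a single variable \<open>z\<close>. The conclusion speaks of
  random shifts because \<open>F\<close> itself may err on any particular set.\<close>

lemma near_dictator:
  fixes F :: "nat set \<Rightarrow> bool"
  assumes near: "set_avg n (\<lambda>S. set_avg n (\<lambda>T. set_avg n (\<lambda>R.
                   of_bool (\<not> dictator_like n F S T R)))) \<le> 1 / 100"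
  obtains z where "z < n"
    "\<And>A. A \<subseteq> {..<n} \<Longrightarrow> z \<in> A \<Longrightarrow>
       set_avg n (\<lambda>X. of_bool (F X = F (sym_diff X A))) \<le> 1 / 2"
proof -
  define bad :: "nat set \<Rightarrow> nat set \<Rightarrow> nat set \<Rightarrow> real" where
    "bad S T R = of_bool (\<not> dictator_like n F S T R)" for S T R
  define nonadd :: "nat set \<Rightarrow> nat set \<Rightarrow> real" where
    "nonadd S T = of_bool (F (sym_diff S T) \<noteq> (F S \<noteq> F T))" for S T
  define a where "a A = set_avg n (\<lambda>X. of_bool (F X \<noteq> F (sym_diff X A)))" for A
  define g where "g A \<longleftrightarrow> a A > 1 / 2" for A
  define e :: "nat set \<Rightarrow> nat set \<Rightarrow> real"
    where "e A X = of_bool ((F X \<noteq> F (sym_diff X A)) \<noteq> g A)" for A X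
  define err where "err A = set_avg n (e A)" for A
  have near': "set_avg n (\<lambda>S. set_avg n (\<lambda>T. set_avg n (bad S T))) \<le> 1 / 100"
    using near unfolding bad_def .
  have nonadd: "set_avg n (\<lambda>S. set_avg n (nonadd S)) \<le> 1 / 100"
  proof (rule order_trans[OF _ near'], intro set_avg_mono set_avg_ge_const)
    fix S T R :: "nat set"
    have "F (sym_diff S T) \<noteq> (F S \<noteq> F T) \<Longrightarrow> \<not> dictator_like n F S T R"
      unfolding dictator_like_def by blast
    then show "nonadd S T \<le> bad S T R"
      unfolding nonadd_def bad_def of_bool_le_iff by blast
  qed
  have a01: "0 \<le> a A" "a A \<le> 1" for A
    unfolding a_def by (auto intro!: set_avg_nonneg set_avg_le_const)
  \<comment> \<open>Two independent votes \<open>X\<close>, \<open>Y\<close> on \<open>A\<close>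
    disagree with probability \<open>2 * a A * (1 - a A)\<close>. They disagree only if additivity
    fails at \<open>X\<close>, \<open>Y\<close> or at their translates by \<open>A\<close>, so the
    minority vote has probability at most \<open>1 / 50\<close>.\<close>
  have err: "err A \<le> 1 / 50" if A: "A \<subseteq> {..<n}" for A
  proof -
    define b :: "nat set \<Rightarrow> real" where "b X = of_bool (F X \<noteq> F (sym_diff X A))" for X
    have avg_b: "set_avg n b = a A"
      by (simp only: a_def b_def[abs_def])
    have "2 * a A * (1 - a A) = set_avg n (\<lambda>X. set_avg n (\<lambda>Y. b X + b Y - 2 * (b X * b Y)))"
      unfolding set_avg_add set_avg_diff set_avg_cmult set_avg_multc set_avg_const avg_b
      by (simp add: algebra_simps)
    also have "\<dots> \<le> set_avg n (\<lambda>X. set_avg n (\<lambda>Y. nonadd X Y + nonadd (sym_diff X A) (sym_diff Y A)))"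
    proof (intro set_avg_mono)
      fix X Y :: "nat set"
      have "sym_diff (sym_diff X A) (sym_diff Y A) = sym_diff X Y"
        by auto
      then have eq: "nonadd (sym_diff X A) (sym_diff Y A)
          = of_bool (F (sym_diff X Y) \<noteq> (F (sym_diff X A) \<noteq> F (sym_diff Y A)))"
        by (simp only: nonadd_def)
      have "of_bool (p \<noteq> q) + of_bool (r \<noteq> s) - 2 * (of_bool (p \<noteq> q) * of_bool (r \<noteq> s))
          \<le> (of_bool (u \<noteq> (p \<noteq> r)) + of_bool (u \<noteq> (q \<noteq> s)) :: real)" for p q r s u :: bool
        by (cases p; cases q; cases r; cases s; cases u; simp)
      then show "b X + b Y - 2 * (b X * b Y) \<le> nonadd X Y + nonadd (sym_diff X A) (sym_diff Y A)"
        unfolding eq nonadd_def[of X Y] b_def .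
    qed
    also have "\<dots> = 2 * set_avg n (\<lambda>S. set_avg n (nonadd S))"
      unfolding set_avg_add
      by (subst set_avg_shift[OF A, where \<phi> = "\<lambda>X. set_avg n (\<lambda>Y. nonadd X (sym_diff Y A))"])
         (subst set_avg_shift[OF A], simp)
    finally have *: "a A * (1 - a A) \<le> 1 / 100"
      using nonadd by simp
    show ?thesis
    proof (cases "g A")
      case True
      then have "1 - a A \<le> 2 * (a A * (1 - a A))"
        using a01[of A] mult_right_mono[of "1/2" "a A" "1 - a A"] by (simp add: g_def)
      moreover have "err A = 1 - a A"
        using True set_avg_of_bool_not[of n "\<lambda>X. F X \<noteq> F (sym_diff X A)"]
        by (simp add: err_def e_def[abs_def] a_def)
      ultimately show ?thesis
        using * by simp
    next
      case False
      then have "a A \<le> 2 * (a A * (1 - a A))"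
        using a01[of A] mult_left_mono[of "1/2" "1 - a A" "a A"] by (simp add: g_def)
      moreover have "err A = a A"
        using False by (simp add: err_def e_def[abs_def] a_def)
      ultimately show ?thesis
        using * by simp
    qed
  qed
  have g_add: "g (sym_diff A A') \<longleftrightarrow> g A \<noteq> g A'" if A: "A \<subseteq> {..<n}" "A' \<subseteq> {..<n}" for A A'
  proof (rule ccontr)
    assume neq: "\<not> ?thesis"
    have AA: "sym_diff A A' \<subseteq> {..<n}"
      using A by auto
    \<comment> \<open>The three votes telescope along \<open>X\<close>, \<open>sym_diff X A\<close>
      and the common endpoint. If \<open>g\<close> were not additive, one of them would contradict
      \<open>g\<close> for every \<open>X\<close>, but wrong votes have total probability at most
      \<open>3 / 50\<close>.\<close>
    have "1 \<le> set_avg n (\<lambda>X. e A X + e A' (sym_diff X A) + e (sym_diff A A') X)"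
    proof (rule set_avg_ge_const)
      fix X :: "nat set"
      have "sym_diff X (sym_diff A A') = sym_diff (sym_diff X A) A'"
        by auto
      then have eq: "F (sym_diff X (sym_diff A A')) = F (sym_diff (sym_diff X A) A')"
        by (rule arg_cong)
      have ineq: "w = t \<Longrightarrow> \<not> (x \<longleftrightarrow> y \<noteq> y') \<Longrightarrow> 1 \<le> of_bool ((r \<noteq> s) \<noteq> y) + of_bool ((s \<noteq> t) \<noteq> y')
          + (of_bool ((r \<noteq> w) \<noteq> x) :: real)" for r s t w x y y' :: bool
        by (cases r; cases s; cases t; cases x; cases y; cases y'; simp)
      show "1 \<le> e A X + e A' (sym_diff X A) + e (sym_diff A A') X"
        unfolding e_def by (rule ineq[OF eq neq])
    qed
    also have "\<dots> = err A + err A' + err (sym_diff A A')"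
      unfolding set_avg_add set_avg_shift[OF A(1), of "e A'"] by (simp add: err_def)
    also have "\<dots> \<le> 3 / 50"
      using err[OF A(1)] err[OF A(2)] err[OF AA] by simp
    finally show False
      by simp
  qed
  have g_empty: "\<not> g {}"
    by (simp add: g_def a_def)
  have g_zero: "\<not> g A" if "A \<subseteq> {..<n}" "\<And>z. z \<in> A \<Longrightarrow> \<not> g {z}" for A
    using finite_subset[OF that(1) finite_lessThan] that
  proof (induction A rule: finite_induct)
    case (insert z A)
    have "insert z A = sym_diff {z} A"
      using insert.hyps by auto
    then show ?case
      using insert g_add[of "{z}" A] by auto
  qed (simp add: g_empty)
  have "g {..<n}"
  proof -
    have "1 - a {..<n} = set_avg n (\<lambda>S. of_bool (F S = F (sym_diff S {..<n})))"
      unfolding a_def set_avg_of_bool_not diff_diff_eq2 by simp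
    also have "\<dots> \<le> set_avg n (\<lambda>S. set_avg n (\<lambda>T. set_avg n (bad S T)))"
    proof (intro set_avg_mono set_avg_ge_const)
      fix S T R :: "nat set"
      have "F S = F (sym_diff S {..<n}) \<Longrightarrow> \<not> dictator_like n F S T R"
        unfolding dictator_like_def by blast
      then show "of_bool (F S = F (sym_diff S {..<n})) \<le> bad S T R"
        unfolding bad_def of_bool_le_iff by blast
    qed
    finally show ?thesis
      using near' by (simp add: g_def)
  qed
  then obtain z where z: "z < n" "g {z}"
    using g_zero[of "{..<n}"] by auto
  have unique: "y = z" if y: "y < n" "g {y}" for y
  proof (rule ccontr)
    assume "y \<noteq> z"
    \<comment> \<open>\<open>q\<close> marks the pairs on which the self-corrected function violates
      disjointness. Its average is at most \<open>1 / 100 + 2 / 50 = 1 / 20\<close> by the tests,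
      but at least \<open>1 / 16\<close> if \<open>g\<close> were true at two variables.\<close>
    define q :: "nat set \<Rightarrow> nat set \<Rightarrow> real" where
      "q S T = of_bool (g (S \<inter> T) \<and> g (S - T))" for S T
    have le: "set_avg n (\<lambda>S. set_avg n (q S)) \<le> 1 / 20"
    proof -
      have "set_avg n (\<lambda>S. set_avg n (q S))
          \<le> set_avg n (\<lambda>S. set_avg n (\<lambda>T. set_avg n (\<lambda>R. bad S T R + e (S \<inter> T) R + e (S - T) R)))"
      proof (intro set_avg_mono set_avg_ge_const)
        fix S T R :: "nat set"
        have imp: "g (S \<inter> T) \<and> g (S - T) \<Longrightarrow> \<not> dictator_like n F S T R
            \<or> (F R \<noteq> F (sym_diff R (S \<inter> T))) \<noteq> g (S \<inter> T)
            \<or> (F R \<noteq> F (sym_diff R (S - T))) \<noteq> g (S - T)"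
          unfolding dictator_like_def by blast
        have le: "(p \<Longrightarrow> p1 \<or> p2 \<or> p3) \<Longrightarrow> of_bool p \<le> of_bool p1 + of_bool p2 + (of_bool p3 :: real)"
          for p p1 p2 p3
          by (cases p; cases p1; cases p2; cases p3; simp)
        show "q S T \<le> bad S T R + e (S \<inter> T) R + e (S - T) R"
          unfolding q_def bad_def e_def by (rule le, rule imp)
      qed
      also have "\<dots> \<le> set_avg n (\<lambda>S. set_avg n (\<lambda>T. set_avg n (bad S T) + 1 / 25))"
      proof (intro set_avg_mono)
        fix S T :: "nat set"
        assume ST: "S \<subseteq> {..<n}" "T \<subseteq> {..<n}"
        have "err (S \<inter> T) \<le> 1 / 50" "err (S - T) \<le> 1 / 50"
          by (rule err, use ST in blast)+
        then show "set_avg n (\<lambda>R. bad S T R + e (S \<inter> T) R + e (S - T) R) \<le> set_avg n (bad S T) + 1 / 25"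
          by (simp add: set_avg_add err_def)
      qed
      also have "\<dots> \<le> 1 / 20"
        using near' by (simp add: set_avg_add)
      finally show ?thesis .
    qed
    \<comment> \<open>Changing \<open>S\<close> and \<open>T\<close> only on \<open>{y, z}\<close>
      reaches a pair with \<open>q = 1\<close>, so one of the 16 translates of any pair
      counts.\<close>
    let ?P = "Pow {y, z}"
    have "1 \<le> set_avg n (\<lambda>S. set_avg n (\<lambda>T. \<Sum>C\<in>?P. \<Sum>C'\<in>?P. q (sym_diff S C) (sym_diff T C')))"
    proof (intro set_avg_ge_const)
      fix S T :: "nat set"
      assume ST: "S \<subseteq> {..<n}" "T \<subseteq> {..<n}"
      define S0 T0 where "S0 = S - {y, z}" and "T0 = T - {y, z}"
      \<comment> \<open>\<open>y\<close> is put into the intersection, and \<open>z\<close> into the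
        difference, exactly when that is needed to make \<open>g\<close> true there.\<close>
      define Cy where "Cy = (if g (S0 \<inter> T0) then {} else {y})"
      define Cz where "Cz = (if g (S0 - T0) then {} else {z})"
      define S' T' where "S' = S0 \<union> Cy \<union> Cz" and "T' = T0 \<union> Cy"
      have "S' \<inter> T' = sym_diff (S0 \<inter> T0) Cy" "S' - T' = sym_diff (S0 - T0) Cz"
        using \<open>y \<noteq> z\<close> by (auto simp: S'_def T'_def S0_def T0_def Cy_def Cz_def)
      moreover have "g (sym_diff (S0 \<inter> T0) Cy)"
        using g_add[of "S0 \<inter> T0" "{y}"] y ST by (auto simp: Cy_def S0_def)
      moreover have "g (sym_diff (S0 - T0) Cz)"
        using g_add[of "S0 - T0" "{z}"] z ST by (auto simp: Cz_def S0_def)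
      moreover define C C' where "C = sym_diff S S'" and "C' = sym_diff T T'"
      moreover have "sym_diff S C = S'" "sym_diff T C' = T'"
        by (auto simp: C_def C'_def)
      ultimately have q1: "q (sym_diff S C) (sym_diff T C') = 1"
        by (simp add: q_def)
      have CP: "C \<in> ?P" "C' \<in> ?P"
        by (auto simp: C_def C'_def S'_def T'_def S0_def T0_def Cy_def Cz_def split: if_splits)
      have q0: "q A B \<ge> 0" for A B
        by (simp add: q_def)
      have "1 \<le> (\<Sum>D'\<in>?P. q (sym_diff S C) (sym_diff T D'))"
        unfolding q1[symmetric] by (rule member_le_sum[OF CP(2)]) (auto simp: q0)
      also have "\<dots> \<le> (\<Sum>D\<in>?P. \<Sum>D'\<in>?P. q (sym_diff S D) (sym_diff T D'))"
        by (rule member_le_sum[OF CP(1)]) (auto simp: q0 intro!: sum_nonneg)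
      finally show "1 \<le> (\<Sum>D\<in>?P. \<Sum>D'\<in>?P. q (sym_diff S D) (sym_diff T D'))" .
    qed
    also have "\<dots> = (\<Sum>C\<in>?P. \<Sum>C'\<in>?P. set_avg n (\<lambda>S. set_avg n (\<lambda>T. q (sym_diff S C) (sym_diff T C'))))"
      by (simp only: set_avg_sum)
    also have "\<dots> = (\<Sum>C\<in>?P. \<Sum>C'\<in>?P. set_avg n (\<lambda>S. set_avg n (q S)))"
    proof (intro sum.cong refl)
      fix C C'
      assume "C \<in> ?P" "C' \<in> ?P"
      then have C: "C \<subseteq> {..<n}" "C' \<subseteq> {..<n}"
        using y z by auto
      show "set_avg n (\<lambda>S. set_avg n (\<lambda>T. q (sym_diff S C) (sym_diff T C'))) = set_avg n (\<lambda>S. set_avg n (q S))"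
        using set_avg_shift[OF C(1), of "\<lambda>S. set_avg n (\<lambda>T. q S (sym_diff T C'))"]
        by (simp add: set_avg_shift[OF C(2)])
    qed
    also have "\<dots> = 16 * set_avg n (\<lambda>S. set_avg n (q S))"
      using \<open>y \<noteq> z\<close> by (simp add: card_Pow)
    finally show False
      using le by simp
  qed
  have dictator: "g A" if A: "A \<subseteq> {..<n}" "z \<in> A" for A
  proof -
    have "A = sym_diff {z} (A - {z})"
      using A by auto
    moreover have "\<not> g (A - {z})"
      by (rule g_zero) (use A unique in auto)
    ultimately show ?thesis
      using g_add[of "{z}" "A - {z}"] z A by auto
  qed
  show ?thesis
  proof (rule that[OF z(1)])
    fix A assume A: "A \<subseteq> {..<n}" "z \<in> A"
    have "set_avg n (\<lambda>X. of_bool (F X = F (sym_diff X A))) = 1 - a A"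
      unfolding a_def set_avg_of_bool_not by simp
    also have "\<dots> \<le> 1 / 2"
      using dictator[OF A] by (simp add: g_def)
    finally show "set_avg n (\<lambda>X. of_bool (F X = F (sym_diff X A))) \<le> 1 / 2" .
  qed
qed

subsection \<open>Relevant blocks\<close>

definition flip :: "nat \<Rightarrow> nat set \<Rightarrow> bool list \<Rightarrow> bool list" where
  "flip n A x = map (\<lambda>i. x ! i \<noteq> (i \<in> A)) [0..<n]"

lemma flip_in_cube [simp]: "flip n A x \<in> cube n"
  by (simp add: flip_def cube_def)

lemma flip_nth [simp]: "i < n \<Longrightarrow> flip n A x ! i \<longleftrightarrow> x ! i \<noteq> (i \<in> A)"
  by (simp add: flip_def)

lemma flip_empty: "x \<in> cube n \<Longrightarrow> flip n {} x = x"
  by (intro nth_equalityI) (auto simp: flip_def cube_def)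

lemma flip_flip: "flip n A (flip n B x) = flip n (sym_diff A B) x"
  by (intro nth_equalityI) (auto simp: flip_def)

definition graph :: "nat \<Rightarrow> (bool list \<Rightarrow> bool) \<Rightarrow> (bool list \<times> bool) set" where
  "graph n f = {(x, f x) |x. x \<in> cube n}"

lemma mem_graph: "(x, b) \<in> graph n f \<longleftrightarrow> x \<in> cube n \<and> b = f x"
  by (auto simp: graph_def)

text \<open>The condition refers to the transcript \<open>K\<close> alone and not to
  \<open>f\<close>, so that the tester can evaluate it. The same holds for
  \<open>certificate\<close> and \<open>growable\<close>.\<close>

definition relevant :: "nat \<Rightarrow> (bool list \<times> bool) set \<Rightarrow> nat set \<Rightarrow> bool" where
  "relevant n K A \<longleftrightarrow> (\<exists>z b. (z, b) \<in> K \<and> (flip n A z, \<not> b) \<in> K)"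

lemma relevantI:
  "(z, f z) \<in> K \<Longrightarrow> (flip n A z, f (flip n A z)) \<in> K \<Longrightarrow> f z \<noteq> f (flip n A z) \<Longrightarrow> relevant n K A"
  unfolding relevant_def by (intro exI[of _ z] exI[of _ "f z"]) (cases "f z"; cases "f (flip n A z)"; simp)

lemma relevant_mono: "relevant n K A \<Longrightarrow> K \<subseteq> K' \<Longrightarrow> relevant n K' A"
  unfolding relevant_def by blast

lemma relevant_witness:
  assumes "relevant n K A" "K \<subseteq> graph n f"
  shows "\<exists>z. (z, f z) \<in> K \<and> z \<in> cube n \<and> f z \<noteq> f (flip n A z)"
  using assms unfolding relevant_def by (auto simp: graph_def)

definition certificate :: "nat \<Rightarrow> (bool list \<times> bool) set \<Rightarrow> nat set list \<Rightarrow> bool" where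
  "certificate n K Bs \<longleftrightarrow>
     sorted_wrt (\<lambda>A B. A \<inter> B = {}) Bs \<and> (\<forall>B \<in> set Bs. B \<subseteq> {..<n} \<and> relevant n K B)"

text \<open>The longer certificate need not extend \<open>Bs\<close>: a split replaces one block by
  two smaller ones.\<close>

definition growable :: "nat \<Rightarrow> (bool list \<times> bool) set \<Rightarrow> nat set list \<Rightarrow> bool" where
  "growable n K Bs \<longleftrightarrow> (\<exists>Bs'. certificate n K Bs' \<and> length Bs' = Suc (length Bs))"

lemma certificate_mono: "certificate n K Bs \<Longrightarrow> K \<subseteq> K' \<Longrightarrow> certificate n K' Bs"
  unfolding certificate_def using relevant_mono by blast

lemma growable_mono: "growable n K Bs \<Longrightarrow> K \<subseteq> K' \<Longrightarrow> growable n K' Bs"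
  unfolding growable_def using certificate_mono by blast

lemma sorted_wrt_disjointD:
  "sorted_wrt (\<lambda>A B. A \<inter> B = {}) Bs \<Longrightarrow> A \<in> set Bs \<Longrightarrow> B \<in> set Bs \<Longrightarrow> A \<noteq> B \<Longrightarrow> A \<inter> B = {}"
  by (induction Bs) (auto simp: Int_commute)

lemma growable_new_block:
  assumes "certificate n K Bs" "relevant n K A" "A \<subseteq> {..<n}" "A \<inter> \<Union>(set Bs) = {}"
  shows "growable n K Bs"
  using assms unfolding growable_def certificate_def
  by (intro exI[of _ "A # Bs"]) auto

text \<open>\<open>A\<close> and \<open>A'\<close> take the place of \<open>B\<close>; variables of
  \<open>B\<close> in neither of them leave the blocks.\<close>

lemma growable_split_block:
  assumes cert: "certificate n K Bs" and B: "B \<in> set Bs"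
    and A: "A \<subseteq> B" "A' \<subseteq> B" "A \<inter> A' = {}" "relevant n K A" "relevant n K A'"
  shows "growable n K Bs"
proof -
  obtain xs ys where Bs: "Bs = xs @ B # ys"
    using split_list[OF B] by blast
  let ?disj = "\<lambda>A B. A \<inter> B = {}"
  have srt: "sorted_wrt ?disj (xs @ ys)"
    and out: "\<And>Y. Y \<in> set (xs @ ys) \<Longrightarrow> B \<inter> Y = {} \<and> Y \<subseteq> {..<n} \<and> relevant n K Y"
    and BN: "B \<subseteq> {..<n}"
    using cert by (auto simp: certificate_def Bs sorted_wrt_append)
  have "sorted_wrt ?disj (A # A' # xs @ ys)"
    unfolding sorted_wrt.simps(2) using srt out A by (simp only: list.set) blast
  moreover have "\<forall>Y \<in> set (A # A' # xs @ ys). Y \<subseteq> {..<n} \<and> relevant n K Y"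
    using out A BN by (simp only: list.set) blast
  ultimately have "certificate n K (A # A' # xs @ ys)"
    unfolding certificate_def by blast
  then show ?thesis
    unfolding growable_def using Bs by (intro exI[of _ "A # A' # xs @ ys"]) simp
qed

section \<open>Dictators on a Boolean algebra of sets\<close>

text \<open>Of a set and its complement at most one can influence \<open>F\<close> on
  \<open>\<A>\<close>. Shifting by the one without influence is free, which spreads the values at
  \<open>{}\<close> and \<open>{..<n}\<close> to complementation and additivity on all of
  \<open>\<A>\<close>.\<close>

lemma dictator_likeI:
  fixes \<A> :: "nat set set"
  assumes sym_diff: "\<And>X Y. X \<in> \<A> \<Longrightarrow> Y \<in> \<A> \<Longrightarrow> sym_diff X Y \<in> \<A>"
    and inter: "\<And>X Y. X \<in> \<A> \<Longrightarrow> Y \<in> \<A> \<Longrightarrow> X \<inter> Y \<in> \<A>"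
    and top: "{..<n} \<in> \<A>" and sub: "\<And>X. X \<in> \<A> \<Longrightarrow> X \<subseteq> {..<n}"
    and F: "\<not> F {}" "F {..<n}"
    and no_two: "\<And>A A' X Y. A \<in> \<A> \<Longrightarrow> A' \<in> \<A> \<Longrightarrow> X \<in> \<A> \<Longrightarrow> Y \<in> \<A> \<Longrightarrow> A \<inter> A' = {} \<Longrightarrow>
      F X \<noteq> F (sym_diff X A) \<Longrightarrow> F Y \<noteq> F (sym_diff Y A') \<Longrightarrow> False"
    and STR: "S \<in> \<A>" "T \<in> \<A>" "R \<in> \<A>"
  shows "dictator_like n F S T R"
proof -
  define r where "r A \<longleftrightarrow> (\<exists>X \<in> \<A>. F X \<noteq> F (sym_diff X A))" for A
  have empty: "{} \<in> \<A>"
    using sym_diff[OF top top] by simp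
  have r_disjoint: "\<not> (r A \<and> r A')" if "A \<in> \<A>" "A' \<in> \<A>" "A \<inter> A' = {}" for A A'
    using no_two that unfolding r_def by blast
  have not_r: "F (sym_diff X A) = F X" if "\<not> r A" "X \<in> \<A>" for A X
    using that unfolding r_def by blast
  \<comment> \<open>Whichever of \<open>U\<close> and its complement has no influence moves
    \<open>{}\<close> and \<open>{..<n}\<close> to \<open>U\<close> and its complement, in some
    order, without changing values.\<close>
  have compl: "F (sym_diff U {..<n}) \<longleftrightarrow> \<not> F U" if U: "U \<in> \<A>" for U
  proof -
    have UN: "sym_diff U {..<n} \<in> \<A>"
      using U top by (rule sym_diff)
    have eqs: "sym_diff {..<n} U = sym_diff U {..<n}" "sym_diff U (sym_diff U {..<n}) = {..<n}"
      by auto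
    have "\<not> r U \<or> \<not> r (sym_diff U {..<n})"
      using r_disjoint[OF U UN] sub[OF U] by blast
    then show ?thesis
    proof
      assume "\<not> r U"
      then show ?thesis
        using not_r[of U "{}"] not_r[of U "{..<n}"] empty top F eqs by simp
    next
      assume "\<not> r (sym_diff U {..<n})"
      then show ?thesis
        using not_r[of "sym_diff U {..<n}" "{}"] not_r[of "sym_diff U {..<n}" U] empty U F eqs by simp
    qed
  qed
  have add: "F (sym_diff U A) \<longleftrightarrow> F U \<noteq> F A" if U: "U \<in> \<A>" and A: "A \<in> \<A>" for U A
  proof (cases "r A")
    case True
    \<comment> \<open>If \<open>A\<close> has influence, its complement has none, so shifting by
      \<open>A\<close> amounts to shifting by \<open>{..<n}\<close>, that is, to negation.\<close>
    have AN: "sym_diff A {..<n} \<in> \<A>"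
      using A top by (rule sym_diff)
    have "A \<inter> sym_diff A {..<n} = {}"
      using sub[OF A] by blast
    then have no: "\<not> r (sym_diff A {..<n})"
      using True r_disjoint[OF A AN] by blast
    have "F (sym_diff V A) \<longleftrightarrow> \<not> F V" if V: "V \<in> \<A>" for V
    proof -
      have "sym_diff (sym_diff V A) (sym_diff A {..<n}) = sym_diff V {..<n}"
        by auto
      then show ?thesis
        using not_r[OF no sym_diff[OF V A]] compl[OF V] by simp
    qed
    from this[OF U] this[OF empty] show ?thesis
      using F by simp
  next
    case False
    then show ?thesis
      using not_r[OF False U] not_r[OF False empty] F by simp
  qed
  have "S - T = sym_diff S (S \<inter> T)"
    by auto
  then have ST: "S \<inter> T \<in> \<A>" "S - T \<in> \<A>"
    using STR inter sym_diff by metis+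
  have "\<not> (F (S \<inter> T) \<and> F (S - T))"
    using no_two[OF ST empty empty] F by auto
  then show ?thesis
    unfolding dictator_like_def using add compl STR ST by blast
qed

text \<open>\<open>range (venn n S R U)\<close> is the Boolean algebra generated by the three sets.
  Indexing it by the 256 Boolean functions of three bits makes it enumerable, so that all its
  members can be queried.\<close>

definition venn ::
    "nat \<Rightarrow> nat set \<Rightarrow> nat set \<Rightarrow> nat set \<Rightarrow> (bool \<Rightarrow> bool \<Rightarrow> bool \<Rightarrow> bool) \<Rightarrow> nat set" where
  "venn n S R U \<phi> = {i. i < n \<and> \<phi> (i \<in> S) (i \<in> R) (i \<in> U)}"

lemma range_vennI:
  assumes "\<And>i. i \<in> X \<longleftrightarrow> i < n \<and> \<phi> (i \<in> S) (i \<in> R) (i \<in> U)"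
  shows "X \<in> range (venn n S R U)"
  using assms by (intro range_eqI[of _ _ \<phi>]) (auto simp: venn_def)

lemma range_venn_ops:
  assumes "X \<in> range (venn n S R U)" "Y \<in> range (venn n S R U)"
  shows "sym_diff X Y \<in> range (venn n S R U)" "X \<inter> Y \<in> range (venn n S R U)"
proof -
  obtain \<phi> \<psi> where XY: "X = venn n S R U \<phi>" "Y = venn n S R U \<psi>"
    using assms by blast
  show "sym_diff X Y \<in> range (venn n S R U)"
    unfolding XY by (rule range_vennI[where \<phi> = "\<lambda>a b c. \<phi> a b c \<noteq> \<psi> a b c"]) (auto simp: venn_def)
  show "X \<inter> Y \<in> range (venn n S R U)"
    unfolding XY by (rule range_vennI[where \<phi> = "\<lambda>a b c. \<phi> a b c \<and> \<psi> a b c"]) (auto simp: venn_def)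
qed

lemma range_venn_generators:
  assumes "S \<subseteq> {..<n}" "R \<subseteq> {..<n}" "U \<subseteq> {..<n}"
  shows "{} \<in> range (venn n S R U)" "{..<n} \<in> range (venn n S R U)"
    "S \<in> range (venn n S R U)" "R \<in> range (venn n S R U)" "U \<in> range (venn n S R U)"
proof -
  show "{} \<in> range (venn n S R U)" by (rule range_vennI[where \<phi> = "\<lambda>a b c. False"]) auto
  show "{..<n} \<in> range (venn n S R U)" by (rule range_vennI[where \<phi> = "\<lambda>a b c. True"]) auto
  show "S \<in> range (venn n S R U)" by (rule range_vennI[where \<phi> = "\<lambda>a b c. a"]) (use assms in auto)
  show "R \<in> range (venn n S R U)" by (rule range_vennI[where \<phi> = "\<lambda>a b c. b"]) (use assms in auto)
  show "U \<in> range (venn n S R U)" by (rule range_vennI[where \<phi> = "\<lambda>a b c. c"]) (use assms in auto)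
qed

definition block_fun :: "nat \<Rightarrow> (bool list \<Rightarrow> bool) \<Rightarrow> nat set \<Rightarrow> bool list \<Rightarrow> nat set \<Rightarrow> bool" where
  "block_fun n f B w X \<longleftrightarrow> f (flip n (X \<inter> B) w) \<noteq> f w"

definition probed ::
    "nat \<Rightarrow> (bool list \<Rightarrow> bool) \<Rightarrow> (bool list \<times> bool) set \<Rightarrow> nat set \<Rightarrow> bool list \<Rightarrow> nat set \<Rightarrow> bool" where
  "probed n f K B w X \<longleftrightarrow> (flip n (X \<inter> B) w, f (flip n (X \<inter> B) w)) \<in> K"

text \<open>The two probed points differ exactly on \<open>A \<inter> B\<close>, and different
  values of the block function mean different values of \<open>f\<close>.\<close>

lemma relevant_probed:
  assumes "probed n f K B w X" "probed n f K B w (sym_diff X A)"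
    and "block_fun n f B w X \<noteq> block_fun n f B w (sym_diff X A)"
  shows "relevant n K (A \<inter> B)"
proof (rule relevantI)
  have eq: "flip n (A \<inter> B) (flip n (X \<inter> B) w) = flip n (sym_diff X A \<inter> B) w"
    unfolding flip_flip by (rule arg_cong[where f = "\<lambda>C. flip n C w"]) auto
  show "(flip n (X \<inter> B) w, f (flip n (X \<inter> B) w)) \<in> K"
    using assms by (simp add: probed_def)
  show "(flip n (A \<inter> B) (flip n (X \<inter> B) w), f (flip n (A \<inter> B) (flip n (X \<inter> B) w))) \<in> K"
    using assms unfolding eq by (simp add: probed_def)
  show "f (flip n (X \<inter> B) w) \<noteq> f (flip n (A \<inter> B) (flip n (X \<inter> B) w))"
    using assms(3) unfolding eq block_fun_def by blast
qed

text \<open>If the blocks cannot grow, no two disjoint sets of the algebra both influence the block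
  function, since their traces on \<open>B\<close> would split \<open>B\<close>. Then
  \<open>dictator_likeI\<close> applies.\<close>

lemma growable_if_not_dictator_like:
  assumes cert: "certificate n K Bs" and B: "B \<in> set Bs"
    and w: "w \<in> cube n" "f w \<noteq> f (flip n B w)"
    and sub: "S \<subseteq> {..<n}" "R \<subseteq> {..<n}" "U \<subseteq> {..<n}"
    and probed: "\<And>X. X \<in> range (venn n S R U) \<Longrightarrow> probed n f K B w X"
    and not_dict: "\<not> dictator_like n (block_fun n f B w) S R U"
  shows "growable n K Bs"
proof (rule ccontr)
  assume stuck: "\<not> growable n K Bs"
  have BN: "B \<subseteq> {..<n}"
    using cert B by (auto simp: certificate_def)
  have "dictator_like n (block_fun n f B w) S R U"
  proof (rule dictator_likeI[where \<A> = "range (venn n S R U)"])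
    show "\<not> block_fun n f B w {}"
      using w by (simp add: block_fun_def flip_empty)
    have "{..<n} \<inter> B = B"
      using BN by auto
    then show "block_fun n f B w {..<n}"
      using w by (auto simp: block_fun_def)
  next
    fix A A' X Y
    assume mem: "A \<in> range (venn n S R U)" "A' \<in> range (venn n S R U)"
      "X \<in> range (venn n S R U)" "Y \<in> range (venn n S R U)" and "A \<inter> A' = {}"
      and ne: "block_fun n f B w X \<noteq> block_fun n f B w (sym_diff X A)"
        "block_fun n f B w Y \<noteq> block_fun n f B w (sym_diff Y A')"
    have "relevant n K (A \<inter> B)"
      by (rule relevant_probed[OF probed[OF mem(3)] probed[OF range_venn_ops(1)[OF mem(3,1)]] ne(1)])
    moreover have "relevant n K (A' \<inter> B)"
      by (rule relevant_probed[OF probed[OF mem(4)] probed[OF range_venn_ops(1)[OF mem(4,2)]] ne(2)])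
    ultimately show False
      using growable_split_block[OF cert B, of "A \<inter> B" "A' \<inter> B"] \<open>A \<inter> A' = {}\<close> stuck by blast
  qed (use sub range_venn_generators range_venn_ops in \<open>auto simp: venn_def\<close>)
  with not_dict show False
    by contradiction
qed

text \<open>\<open>pivot\<close> complements \<open>S\<close> on the blocks whose dictator is believed to lie in \<open>S\<close>, so that it
  avoids all dictators.\<close>

definition pivot :: "nat \<Rightarrow> (bool list \<times> bool) set \<Rightarrow> nat set list \<Rightarrow> nat set \<Rightarrow> nat set" where
  "pivot n K Bs S = sym_diff S (\<Union>{B \<in> set Bs. relevant n K (S \<inter> B)})"

text \<open>Flipping \<open>B\<close> in two stages, first \<open>S \<inter> B\<close> and then
  \<open>B - S\<close>, changes \<open>f\<close> overall. Without a change in the first stage there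
  is one in the second.\<close>

lemma relevant_complement:
  assumes "w \<in> cube n" "f w \<noteq> f (flip n B w)"
    and "probed n f K B w {}" "probed n f K B w {..<n}" "probed n f K B w S"
    and "S \<subseteq> {..<n}" "B \<subseteq> {..<n}" and "\<not> relevant n K (S \<inter> B)"
  shows "relevant n K (B - S)"
proof -
  have "block_fun n f B w {} = block_fun n f B w (sym_diff {} S)"
    using relevant_probed[of n f K B w "{}" S] assms by fastforce
  moreover have "{..<n} \<inter> B = B"
    using assms by auto
  then have "block_fun n f B w {} \<noteq> block_fun n f B w {..<n}"
    using assms by (auto simp: block_fun_def flip_empty)
  moreover have "sym_diff S ({..<n} - S) = {..<n}"
    using assms by auto
  ultimately have "relevant n K (({..<n} - S) \<inter> B)"
    using relevant_probed[of n f K B w S "{..<n} - S"] assms by simp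
  also have "({..<n} - S) \<inter> B = B - S"
    using assms by auto
  finally show ?thesis .
qed

text \<open>On each block the votes show the side of \<open>S\<close> with \<open>\<tau> B\<close>
  to be relevant. The other side cannot be relevant too, or the block would split, so the guess made
  by \<open>pivot\<close> is exact.\<close>

lemma pivot_eq:
  assumes cert: "certificate n K Bs" and stuck: "\<not> growable n K Bs"
    and vote: "\<And>B. B \<in> set Bs \<Longrightarrow> relevant n K ((if \<tau> B \<in> S then S else sym_diff S {..<n}) \<inter> B)"
  shows "pivot n K Bs S = sym_diff S (\<Union>{B \<in> set Bs. \<tau> B \<in> S})"
proof -
  have "relevant n K (S \<inter> B) \<longleftrightarrow> \<tau> B \<in> S" if B: "B \<in> set Bs" for B
  proof (cases "\<tau> B \<in> S")
    case True
    then show ?thesis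
      using vote[OF B] by simp
  next
    case False
    have "B \<subseteq> {..<n}"
      using cert B by (auto simp: certificate_def)
    then have "sym_diff S {..<n} \<inter> B = B - S"
      by auto
    then have "relevant n K (B - S)"
      using vote[OF B] False by simp
    then have "\<not> relevant n K (S \<inter> B)"
      using growable_split_block[OF cert B, of "B - S" "S \<inter> B"] stuck by blast
    then show ?thesis
      using False by simp
  qed
  then have "{B \<in> set Bs. relevant n K (S \<inter> B)} = {B \<in> set Bs. \<tau> B \<in> S}"
    by auto
  then show ?thesis
    unfolding pivot_def by simp
qed

section \<open>Walks from a point to its flipped copy\<close>

text \<open>For disjoint blocks, point \<open>j\<close> has been flipped on the part of
  \<open>P\<close> off all blocks and in the first \<open>j\<close> blocks. Point
  \<open>Suc j\<close> differs from it on \<open>P \<inter> Bs ! j\<close>.\<close>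

definition hybrid :: "nat \<Rightarrow> nat set list \<Rightarrow> nat set \<Rightarrow> bool list \<Rightarrow> nat \<Rightarrow> bool list" where
  "hybrid n Bs P x j = flip n (P - \<Union>(set (drop j Bs))) x"

text \<open>\<open>f\<close> must change somewhere on the walk from \<open>x\<close> to
  \<open>flip n P x\<close>: on the first leg, which stays off the blocks, or on a later one, which
  stays in a single block.\<close>

lemma relevant_hybrid:
  assumes disj: "sorted_wrt (\<lambda>A B. A \<inter> B = {}) Bs"
    and x: "(x, f x) \<in> K" "f x \<noteq> f (flip n P x)"
    and K: "\<And>j. j \<le> length Bs \<Longrightarrow> (hybrid n Bs P x j, f (hybrid n Bs P x j)) \<in> K"
  shows "relevant n K (P - \<Union>(set Bs)) \<or> (\<exists>B \<in> set Bs. relevant n K (P \<inter> B))"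
proof (cases "f x = f (hybrid n Bs P x 0)")
  case False
  then have "relevant n K (P - \<Union>(set Bs))"
    using x K[of 0] by (intro relevantI[of x f]) (auto simp: hybrid_def)
  then show ?thesis ..
next
  case True
  have "f x \<noteq> f (hybrid n Bs P x (length Bs))"
    using x by (simp add: hybrid_def)
  with True obtain j where j: "j < length Bs" "f (hybrid n Bs P x j) \<noteq> f (hybrid n Bs P x (Suc j))"
    using dec_induct[of 0 "length Bs" "\<lambda>j. f x = f (hybrid n Bs P x j)"] by auto
  have "sorted_wrt (\<lambda>A B. A \<inter> B = {}) (take j Bs @ Bs ! j # drop (Suc j) Bs)"
    unfolding id_take_nth_drop[OF j(1), symmetric] by (rule disj)
  then have "Bs ! j \<inter> \<Union>(set (drop (Suc j) Bs)) = {}"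
    unfolding sorted_wrt_append sorted_wrt.simps by blast
  moreover have "drop j Bs = Bs ! j # drop (Suc j) Bs"
    using j by (simp add: Cons_nth_drop_Suc)
  ultimately have "sym_diff (P \<inter> Bs ! j) (P - \<Union>(set (drop j Bs))) = P - \<Union>(set (drop (Suc j) Bs))"
    by auto
  then have eq: "hybrid n Bs P x (Suc j) = flip n (P \<inter> Bs ! j) (hybrid n Bs P x j)"
    by (simp add: hybrid_def flip_flip)
  have "relevant n K (P \<inter> Bs ! j)"
    using j K[of j] K[of "Suc j"] unfolding eq by (intro relevantI[of "hybrid n Bs P x j" f]) auto
  then show ?thesis
    using j by auto
qed

text \<open>A change off the blocks gives a new block. A change inside \<open>B\<close> is as good,
  because the pivot meets \<open>B\<close> in one of \<open>S \<inter> B\<close> and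
  \<open>B - S\<close> while \<open>K\<close> already shows the other to be relevant: together they
  split \<open>B\<close>.\<close>

lemma growable_if_pivot_changes:
  assumes cert: "certificate n K Bs" and sub: "S \<subseteq> {..<n}" "K \<subseteq> K'"
    and w: "\<And>B. B \<in> set Bs \<Longrightarrow> w B \<in> cube n \<and> f (w B) \<noteq> f (flip n B (w B))"
    and probed: "\<And>B X. B \<in> set Bs \<Longrightarrow> X \<in> {{}, {..<n}, S} \<Longrightarrow> probed n f K B (w B) X"
    and x: "(x, f x) \<in> K'" "f x \<noteq> f (flip n (pivot n K Bs S) x)"
    and hyb: "\<And>j. j \<le> length Bs \<Longrightarrow>
      (hybrid n Bs (pivot n K Bs S) x j, f (hybrid n Bs (pivot n K Bs S) x j)) \<in> K'"
  shows "growable n K' Bs"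
proof -
  let ?P = "pivot n K Bs S"
  have cert': "certificate n K' Bs"
    using cert sub certificate_mono by blast
  have disj: "sorted_wrt (\<lambda>A B. A \<inter> B = {}) Bs"
    using cert by (simp add: certificate_def)
  consider "relevant n K' (?P - \<Union>(set Bs))" | B where "B \<in> set Bs" "relevant n K' (?P \<inter> B)"
    using relevant_hybrid[OF disj x hyb] by blast
  then show ?thesis
  proof cases
    case 1
    have "?P - \<Union>(set Bs) \<subseteq> {..<n}"
      using sub by (auto simp: pivot_def)
    then show ?thesis
      using growable_new_block[OF cert' 1] by blast
  next
    case 2
    have B: "B \<subseteq> {..<n}"
      using cert 2 by (auto simp: certificate_def)
    have outside: "C \<inter> B = {}" if "C \<in> set Bs" "C \<noteq> B" for C
      using sorted_wrt_disjointD[OF disj that(1) 2(1) that(2)] .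
    show ?thesis
    proof (cases "relevant n K (S \<inter> B)")
      case True
      then have "?P \<inter> B = B - S"
        using 2 outside by (auto simp: pivot_def)
      then show ?thesis
        using growable_split_block[OF cert' 2(1), of "S \<inter> B" "B - S"] 2 relevant_mono[OF True sub(2)]
        by auto
    next
      case False
      then have "?P \<inter> B = S \<inter> B"
        using 2 outside unfolding pivot_def by blast
      moreover have "relevant n K (B - S)"
        using relevant_complement[of "w B" n f B K S] w probed 2 B sub False by blast
      ultimately show ?thesis
        using growable_split_block[OF cert' 2(1), of "S \<inter> B" "B - S"] 2 relevant_mono[OF _ sub(2)]
        by auto
    qed
  qed
qed

text \<open>Every relevant block contains a variable of the junta, since otherwise its flip would
  leave \<open>f\<close> unchanged, and disjoint blocks contain different ones.\<close>

lemma length_certificate_le: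
  assumes cert: "certificate n K Bs" and K: "K \<subseteq> graph n f" and f: "junta n k f"
  shows "length Bs \<le> k"
proof -
  obtain js h where js: "length js = k" "\<forall>x \<in> cube n. f x = h (map (\<lambda>i. x ! i) js)" "set js \<subseteq> {..<n}"
    using f unfolding junta_def by blast
  have "\<exists>i. i \<in> B \<inter> set js" if B: "B \<in> set Bs" for B
  proof (rule ccontr)
    assume none: "\<not> (\<exists>i. i \<in> B \<inter> set js)"
    obtain z where z: "z \<in> cube n" "f z \<noteq> f (flip n B z)"
      using relevant_witness[of n K B f] cert B K by (auto simp: certificate_def)
    have "map (\<lambda>i. z ! i) js = map (\<lambda>i. flip n B z ! i) js"
    proof (intro map_cong refl)
      fix i assume "i \<in> set js"
      then have "i < n" "i \<notin> B"
        using none js(3) by auto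
      then show "z ! i = flip n B z ! i"
        by simp
    qed
    then have "f z = f (flip n B z)"
      unfolding js(2)[rule_format, OF z(1)] js(2)[rule_format, OF flip_in_cube] by (rule arg_cong)
    with z show False
      by simp
  qed
  then obtain c where c: "\<And>B. B \<in> set Bs \<Longrightarrow> c B \<in> B \<inter> set js"
    by metis
  have disj: "sorted_wrt (\<lambda>A B. A \<inter> B = {}) Bs"
    using cert by (simp add: certificate_def)
  have nonempty: "\<And>B. B \<in> set Bs \<Longrightarrow> B \<noteq> {}"
    using c by blast
  have "distinct Bs"
    using disj nonempty
  proof (induction Bs)
    case (Cons B Bs)
    then have "B \<inter> B \<noteq> {}" "\<And>C. C \<in> set Bs \<Longrightarrow> B \<inter> C = {}"
      by simp_all
    then have "B \<notin> set Bs"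
      by blast
    with Cons show ?case
      by simp
  qed simp
  then have "length Bs = card (set Bs)"
    by (simp add: distinct_card)
  also have "\<dots> = card (c ` set Bs)"
  proof (intro card_image[symmetric] inj_onI)
    fix A B assume AB: "A \<in> set Bs" "B \<in> set Bs" "c A = c B"
    then have "c A \<in> A \<inter> B"
      using c[of A] c[of B] by auto
    then show "A = B"
      using sorted_wrt_disjointD[OF disj AB(1,2)] by auto
  qed
  also have "\<dots> \<le> card (set js)"
    using c by (intro card_mono) auto
  also have "\<dots> \<le> k"
    using js(1) card_length by metis
  finally show ?thesis .
qed

subsection \<open>The tester\<close>

primrec ask ::
    "bool list list \<Rightarrow> (bool list \<times> bool) set \<Rightarrow> ((bool list \<times> bool) set \<Rightarrow> oracle_alg) \<Rightarrow> oracle_alg"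
  where
  "ask [] K c = c K"
| "ask (x # xs) K c = Query x (\<lambda>b. ask xs (insert (x, b) K) c)"

text \<open>Coins yield numbers, so a random set travels as its binary code.\<close>

definition draw_set :: "nat \<Rightarrow> (nat set \<Rightarrow> oracle_alg) \<Rightarrow> oracle_alg" where
  "draw_set n c = Coin (map_pmf set_encode (pmf_of_set (Pow {..<n}))) (\<lambda>r. c (set_decode r))"

primrec draw_sets :: "nat \<Rightarrow> nat \<Rightarrow> (nat set list \<Rightarrow> oracle_alg) \<Rightarrow> oracle_alg" where
  "draw_sets n 0 c = c []"
| "draw_sets n (Suc m) c = draw_set n (\<lambda>U. draw_sets n m (\<lambda>Us. c (U # Us)))"

definition witness :: "nat \<Rightarrow> (bool list \<times> bool) set \<Rightarrow> nat set \<Rightarrow> bool list" where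
  "witness n K B = (SOME z. \<exists>b. (z, b) \<in> K \<and> (flip n B z, \<not> b) \<in> K)"

text \<open>All the algebras share \<open>S\<close> and \<open>R\<close>; the third generator runs
  through the list. In \<open>test_round\<close> its head serves the dictator test and its tail the
  votes.\<close>

definition probes ::
    "nat \<Rightarrow> (bool list \<times> bool) set \<Rightarrow> nat set list \<Rightarrow> nat set \<Rightarrow> nat set \<Rightarrow> nat set list \<Rightarrow> bool list list"
  where
  "probes n K Bs S R Us =
     concat (map (\<lambda>B. concat (map (\<lambda>U. map (\<lambda>\<phi>. flip n (venn n S R U \<phi> \<inter> B) (witness n K B))
       enum_class.enum) Us)) Bs)"

definition hybrids ::
    "nat \<Rightarrow> (bool list \<times> bool) set \<Rightarrow> nat set list \<Rightarrow> nat set \<Rightarrow> bool list \<Rightarrow> bool list list" where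
  "hybrids n K Bs S x = map (hybrid n Bs (pivot n K Bs S) x) [0..<Suc (length Bs)]"

definition grow :: "nat \<Rightarrow> (bool list \<times> bool) set \<Rightarrow> nat set list \<Rightarrow> nat set list" where
  "grow n K Bs = (if growable n K Bs
     then SOME Bs'. certificate n K Bs' \<and> length Bs' = Suc (length Bs) else Bs)"

text \<open>The probes come first because the hybrids depend on the pivot, which is read off their
  answers.\<close>

definition test_round ::
    "nat \<Rightarrow> nat \<Rightarrow> (bool list \<times> bool) set \<Rightarrow> nat set list \<Rightarrow>
      ((bool list \<times> bool) set \<Rightarrow> nat set list \<Rightarrow> oracle_alg) \<Rightarrow> oracle_alg" where
  "test_round n m K Bs c = Sample (\<lambda>xb. draw_set n (\<lambda>S. draw_set n (\<lambda>R. draw_set n (\<lambda>U. draw_sets n m (\<lambda>Us.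
     ask (probes n K Bs S R (U # Us)) (insert xb K) (\<lambda>K1.
     ask (hybrids n K1 Bs S (fst xb)) K1 (\<lambda>K2. c K2 (grow n K2 Bs))))))))"

primrec tester ::
    "nat \<Rightarrow> nat \<Rightarrow> nat \<Rightarrow> nat \<Rightarrow> (bool list \<times> bool) set \<Rightarrow> nat set list \<Rightarrow> oracle_alg" where
  "tester n k m 0 = (\<lambda>K Bs. Verdict (length Bs \<le> k))"
| "tester n k m (Suc t) = (\<lambda>K Bs.
     if length Bs \<le> k then test_round n m K Bs (tester n k m t) else Verdict False)"

subsection \<open>Cost\<close>

text \<open>The bound covers every branch of the decision tree, whichever \<open>f\<close> and
  \<open>D\<close> produce it, so it can be proved by recursion on the algorithm alone.\<close>

primrec costs_at_most :: "oracle_alg \<Rightarrow> nat \<Rightarrow> bool" where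
  "costs_at_most (Verdict b) = (\<lambda>q. True)"
| "costs_at_most (Query x c) = (\<lambda>q. q > 0 \<and> (\<forall>b. costs_at_most (c b) (q - 1)))"
| "costs_at_most (Sample c) = (\<lambda>q. q > 0 \<and> (\<forall>s. costs_at_most (c s) (q - 1)))"
| "costs_at_most (Coin p c) = (\<lambda>q. \<forall>r. costs_at_most (c r) q)"

lemma costs_at_most_run:
  "costs_at_most A q \<Longrightarrow> r \<in> set_pmf (run f D A) \<Longrightarrow> snd r \<le> q"
proof (induction A arbitrary: q r)
  case (Query x c)
  then obtain r' where "r' \<in> set_pmf (run f D (c (f x)))" "r = apsnd Suc r'"
    by auto
  then show ?case
    using Query.IH[of "c (f x)" "q - 1" r'] Query.prems by fastforce
next
  case (Sample c)
  then obtain x r' where "r' \<in> set_pmf (run f D (c (x, f x)))" "r = apsnd Suc r'"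
    by auto
  then show ?case
    using Sample.IH[of "c (x, f x)" "q - 1" r'] Sample.prems by fastforce
next
  case (Coin p c)
  then obtain i where "r \<in> set_pmf (run f D (c i))"
    by auto
  then show ?case
    using Coin.IH[of "c i" q r] Coin.prems by auto
qed auto

lemma query_complexity_le:
  assumes "costs_at_most A q"
  shows "query_complexity n A \<le> enat q"
  unfolding query_complexity_def using costs_at_most_run[OF assms]
  by (auto intro!: SUP_least)

lemma costs_at_most_mono: "costs_at_most A q \<Longrightarrow> q \<le> q' \<Longrightarrow> costs_at_most A q'"
proof (induction A arbitrary: q q')
  case (Query x c)
  have "costs_at_most (c b) (q' - 1)" for b
    using Query.IH[of "c b" "q - 1" "q' - 1"] Query.prems by (simp add: diff_le_mono)
  then show ?case
    using Query.prems by auto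
next
  case (Sample c)
  have "costs_at_most (c b) (q' - 1)" for b
    using Sample.IH[of "c b" "q - 1" "q' - 1"] Sample.prems by (cases b) (simp add: diff_le_mono)
  then show ?case
    using Sample.prems by auto
next
  case (Coin p c)
  have "costs_at_most (c b) q'" for b
    using Coin.IH[of "c b" q q'] Coin.prems by simp
  then show ?case
    by simp
qed simp

lemma costs_at_most_ask:
  "(\<And>K. costs_at_most (c K) q) \<Longrightarrow> costs_at_most (ask xs K c) (length xs + q)"
  by (induction xs arbitrary: K) auto

lemma costs_at_most_draw_set: "(\<And>S. costs_at_most (c S) q) \<Longrightarrow> costs_at_most (draw_set n c) q"
  by (simp add: draw_set_def)

lemma costs_at_most_draw_sets:
  "(\<And>Us. length Us = m \<Longrightarrow> costs_at_most (c Us) q) \<Longrightarrow> costs_at_most (draw_sets n m c) q"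
  by (induction m arbitrary: c) (auto intro!: costs_at_most_draw_set)

lemma length_probes:
  "length (probes n K Bs S R Us) = length Bs * (length Us * 256)"
proof -
  have "length (enum_class.enum :: (bool \<Rightarrow> bool \<Rightarrow> bool \<Rightarrow> bool) list) = 256"
    by (simp add: card_UNIV_length_enum[symmetric] card_fun)
  then show ?thesis
    by (simp add: probes_def length_concat o_def sum_list_triv)
qed

text \<open>The summands are the sample, 256 probes for each block and each of the
  \<open>Suc m\<close> third generators, and the hybrids, one more than there are blocks.\<close>

lemma costs_at_most_round:
  assumes "\<And>K Bs. costs_at_most (c K Bs) q"
  shows "costs_at_most (test_round n m K Bs c) (1 + length Bs * (Suc m * 256) + Suc (length Bs) + q)"
proof -
  have main: "costs_at_most (draw_set n (\<lambda>S. draw_set n (\<lambda>R. draw_set n (\<lambda>U. draw_sets n m (\<lambda>Us.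
     ask (probes n K Bs S R (U # Us)) (insert xb K) (\<lambda>K1.
     ask (hybrids n K1 Bs S (fst xb)) K1 (\<lambda>K2. c K2 (grow n K2 Bs))))))))
     (length Bs * (Suc m * 256) + (Suc (length Bs) + q))" for xb
  proof (intro costs_at_most_draw_set costs_at_most_draw_sets)
    fix S R U :: "nat set" and Us :: "nat set list"
    assume "length Us = m"
    then have len: "length (probes n K Bs S R (U # Us)) = length Bs * (Suc m * 256)"
      by (simp only: length_probes list.size) simp
    have "costs_at_most (ask (hybrids n K1 Bs S (fst xb)) K1 (\<lambda>K2. c K2 (grow n K2 Bs)))
        (Suc (length Bs) + q)" for K1
      using costs_at_most_ask[of "\<lambda>K2. c K2 (grow n K2 Bs)" q "hybrids n K1 Bs S (fst xb)"] assms
      by (simp add: hybrids_def)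
    from costs_at_most_ask[OF this, of "probes n K Bs S R (U # Us)"]
    show "costs_at_most (ask (probes n K Bs S R (U # Us)) (insert xb K) (\<lambda>K1.
       ask (hybrids n K1 Bs S (fst xb)) K1 (\<lambda>K2. c K2 (grow n K2 Bs))))
       (length Bs * (Suc m * 256) + (Suc (length Bs) + q))"
      unfolding len .
  qed
  have eq: "1 + length Bs * (Suc m * 256) + Suc (length Bs) + q - 1
      = length Bs * (Suc m * 256) + (Suc (length Bs) + q)"
    by simp
  show ?thesis
    unfolding test_round_def costs_at_most.simps eq by (intro conjI allI main) linarith
qed

lemma costs_at_most_tester:
  "costs_at_most (tester n k m t K Bs) (t * (k * (Suc m * 256) + k + 2))"
proof (induction t arbitrary: K Bs)
  case (Suc t)
  show ?case
  proof (cases "length Bs \<le> k")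
    case True
    then have "length Bs * (Suc m * 256) \<le> k * (Suc m * 256)"
      by (rule mult_le_mono1)
    with True have "1 + length Bs * (Suc m * 256) + Suc (length Bs) + t * (k * (Suc m * 256) + k + 2)
        \<le> Suc t * (k * (Suc m * 256) + k + 2)"
      unfolding mult_Suc[of t] by linarith
    with True show ?thesis
      using costs_at_most_mono[OF costs_at_most_round[OF Suc.IH]] by simp
  qed simp
qed simp

lemma queries_within_ask:
  "set xs \<subseteq> X \<Longrightarrow> (\<And>K. queries_within X (c K)) \<Longrightarrow> queries_within X (ask xs K c)"
  by (induction xs arbitrary: K) auto

lemma queries_within_draw_set:
  "(\<And>S. queries_within X (c S)) \<Longrightarrow> queries_within X (draw_set n c)"
  by (simp add: draw_set_def)

lemma queries_within_draw_sets:
  "(\<And>Us. queries_within X (c Us)) \<Longrightarrow> queries_within X (draw_sets n m c)"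
  by (induction m arbitrary: c) (auto intro!: queries_within_draw_set)

lemma queries_in_cube: "set (probes n K Bs S R Us) \<subseteq> cube n" "set (hybrids n K Bs S x) \<subseteq> cube n"
  by (auto simp: probes_def hybrids_def hybrid_def)

lemma queries_within_tester: "queries_within (cube n) (tester n k m t K Bs)"
proof (induction t arbitrary: K Bs)
  case (Suc t)
  have "queries_within (cube n) (test_round n m K Bs (tester n k m t))"
    unfolding test_round_def queries_within.simps
    by (intro allI queries_within_draw_set queries_within_draw_sets queries_within_ask
        queries_in_cube Suc.IH)
  then show ?case
    by simp
qed simp

subsection \<open>Distribution of the verdict\<close>

text \<open>Once the count is forgotten, queries leave no trace in the distribution: only samples
  and coins are random.\<close>

definition verdict :: "(bool list \<Rightarrow> bool) \<Rightarrow> bool list pmf \<Rightarrow> oracle_alg \<Rightarrow> bool pmf" where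
  "verdict f D A = map_pmf fst (run f D A)"

lemma prob_accept_verdict: "prob_accept f D A = pmf (verdict f D A) True"
  unfolding prob_accept_def verdict_def pmf_map
  by (rule arg_cong[where f = "measure_pmf.prob _"]) auto

lemma prob_reject_eq: "prob_reject f D A = 1 - prob_accept f D A"
  unfolding prob_accept_def prob_reject_def
  using measure_pmf.prob_compl[of "{r. fst r}" "run f D A"]
  by (simp add: Compl_eq_Diff_UNIV[symmetric] Collect_neg_eq)

lemma verdict_simps [simp]:
  "verdict f D (Verdict b) = return_pmf b"
  "verdict f D (Query x c) = verdict f D (c (f x))"
  "verdict f D (Sample c') = bind_pmf D (\<lambda>x. verdict f D (c' (x, f x)))"
  "verdict f D (Coin p c'') = bind_pmf p (\<lambda>r. verdict f D (c'' r))"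
  by (auto simp: verdict_def map_bind_pmf pmf.map_comp o_def)

lemma verdict_ask: "verdict f D (ask xs K c) = verdict f D (c (K \<union> (\<lambda>x. (x, f x)) ` set xs))"
  by (induction xs arbitrary: K) auto

lemma verdict_draw_set:
  "verdict f D (draw_set n c) = bind_pmf (pmf_of_set (Pow {..<n})) (\<lambda>S. verdict f D (c S))"
  unfolding draw_set_def verdict_simps bind_map_pmf
proof (intro bind_pmf_cong refl)
  fix S assume "S \<in> set_pmf (pmf_of_set (Pow {..<n}))"
  then have "S \<subseteq> {..<n}"
    by (subst (asm) set_pmf_of_set) auto
  then show "verdict f D (c (set_decode (set_encode S))) = verdict f D (c S)"
    by (simp add: finite_subset)
qed

lemma verdict_draw_sets:
  "verdict f D (draw_sets n m c)
    = bind_pmf (replicate_pmf m (pmf_of_set (Pow {..<n}))) (\<lambda>Us. verdict f D (c Us))"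
  by (induction m arbitrary: c) (auto simp: verdict_draw_set bind_return_pmf bind_assoc_pmf)

definition probe_transcript ::
    "nat \<Rightarrow> (bool list \<Rightarrow> bool) \<Rightarrow> (bool list \<times> bool) set \<Rightarrow> nat set list \<Rightarrow> bool list \<Rightarrow>
      nat set \<Rightarrow> nat set \<Rightarrow> nat set list \<Rightarrow> (bool list \<times> bool) set" where
  "probe_transcript n f K Bs x S R Us = insert (x, f x) K \<union>
     (\<lambda>y. (y, f y)) ` set (probes n K Bs S R Us)"

definition next_transcript ::
    "nat \<Rightarrow> (bool list \<Rightarrow> bool) \<Rightarrow> (bool list \<times> bool) set \<Rightarrow> nat set list \<Rightarrow> bool list \<Rightarrow>
      nat set \<Rightarrow> nat set \<Rightarrow> nat set list \<Rightarrow> (bool list \<times> bool) set" where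
  "next_transcript n f K Bs x S R Us = probe_transcript n f K Bs x S R Us \<union>
     (\<lambda>y. (y, f y)) ` set (hybrids n (probe_transcript n f K Bs x S R Us) Bs S x)"

text \<open>A round affects the rest of the run only through the new transcript, so the distribution
  of that transcript is all that matters.\<close>

definition round_pmf ::
    "nat \<Rightarrow> nat \<Rightarrow> (bool list \<Rightarrow> bool) \<Rightarrow> bool list pmf \<Rightarrow> (bool list \<times> bool) set \<Rightarrow> nat set list \<Rightarrow>
      (bool list \<times> bool) set pmf" where
  "round_pmf n m f D K Bs =
     bind_pmf D (\<lambda>x. bind_pmf (pmf_of_set (Pow {..<n})) (\<lambda>S.
     bind_pmf (pmf_of_set (Pow {..<n})) (\<lambda>R. bind_pmf (pmf_of_set (Pow {..<n})) (\<lambda>U.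
     map_pmf (\<lambda>Us. next_transcript n f K Bs x S R (U # Us))
       (replicate_pmf m (pmf_of_set (Pow {..<n})))))))"

lemma verdict_round:
  "verdict f D (test_round n m K Bs c)
    = bind_pmf (round_pmf n m f D K Bs) (\<lambda>K'. verdict f D (c K' (grow n K' Bs)))"
  by (simp add: test_round_def round_pmf_def verdict_draw_set verdict_draw_sets verdict_ask
      bind_assoc_pmf bind_map_pmf probe_transcript_def next_transcript_def)

lemma next_transcript_bounds:
  assumes "x \<in> cube n" "K \<subseteq> graph n f"
  shows "K \<subseteq> probe_transcript n f K Bs x S R Us"
    "probe_transcript n f K Bs x S R Us \<subseteq> next_transcript n f K Bs x S R Us"
    "next_transcript n f K Bs x S R Us \<subseteq> graph n f"
  using assms queries_in_cube
  by (auto simp: probe_transcript_def next_transcript_def mem_graph dest: subsetD) fastforce+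

lemma set_round_pmf:
  assumes "set_pmf D \<subseteq> cube n" "K \<subseteq> graph n f" "K' \<in> set_pmf (round_pmf n m f D K Bs)"
  shows "K \<subseteq> K'" "K' \<subseteq> graph n f"
proof -
  obtain x S R U Us where x: "x \<in> set_pmf D" and K': "K' = next_transcript n f K Bs x S R (U # Us)"
    using assms(3) by (auto simp: round_pmf_def)
  have "x \<in> cube n"
    using x assms(1) by blast
  from next_transcript_bounds[OF this assms(2), of Bs S R "U # Us"] show "K \<subseteq> K'" "K' \<subseteq> graph n f"
    unfolding K' by blast+
qed

lemma grow:
  assumes "certificate n K Bs"
  shows "certificate n K (grow n K Bs)"
    "length (grow n K Bs) = (if growable n K Bs then Suc (length Bs) else length Bs)"
proof -
  have "certificate n K (grow n K Bs) \<and> length (grow n K Bs) = Suc (length Bs)" if "growable n K Bs"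
    using that someI_ex[of "\<lambda>Bs'. certificate n K Bs' \<and> length Bs' = Suc (length Bs)"]
    by (simp add: grow_def growable_def)
  then show "certificate n K (grow n K Bs)"
    "length (grow n K Bs) = (if growable n K Bs then Suc (length Bs) else length Bs)"
    using assms by (auto simp: grow_def)
qed

text \<open>In every run the blocks stay certified by a truthful transcript, so a junta never allows
  more than \<open>k\<close> of them.\<close>

lemma tester_accepts_junta:
  assumes D: "set_pmf D \<subseteq> cube n" and f: "junta n k f"
    and "K \<subseteq> graph n f" "certificate n K Bs"
  shows "set_pmf (verdict f D (tester n k m t K Bs)) \<subseteq> {True}"
  using assms(3,4)
proof (induction t arbitrary: K Bs)
  case 0
  then show ?case
    using length_certificate_le[OF 0(2,1) f] by simp
next
  case (Suc t)
  have "set_pmf (verdict f D (tester n k m t K' (grow n K' Bs))) \<subseteq> {True}"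
    if "K' \<in> set_pmf (round_pmf n m f D K Bs)" for K'
    using set_round_pmf[OF D Suc.prems(1) that]
    by (intro Suc.IH grow(1) certificate_mono[OF Suc.prems(2)])
  then have "set_pmf (verdict f D (test_round n m K Bs (tester n k m t))) \<subseteq> {True}"
    unfolding verdict_round set_bind_pmf by (rule UN_least)
  then show ?case
    using length_certificate_le[OF Suc.prems(2,1) f] by simp
qed

lemma expectation_le_affine_prob:
  fixes M :: "'a pmf"
  assumes "\<And>x. x \<in> set_pmf M \<Longrightarrow> \<phi> x \<le> c - d * indicator A x" "\<And>x. 0 \<le> \<phi> x" "\<And>x. \<phi> x \<le> 1"
  shows "measure_pmf.expectation M \<phi> \<le> c - d * measure_pmf.prob M A"
proof -
  have int: "integrable (measure_pmf M) (\<lambda>x. d * indicator A x)"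
    by (rule measure_pmf.integrable_const_bound[where B = "\<bar>d\<bar>"]) (auto simp: indicator_def)
  have "measure_pmf.expectation M \<phi> \<le> measure_pmf.expectation M (\<lambda>x. c - d * indicator A x)"
  proof (rule integral_mono_AE)
    show "integrable (measure_pmf M) \<phi>"
      by (rule measure_pmf.integrable_const_bound[where B = 1]) (use assms(2,3) in auto)
    show "AE x in measure_pmf M. \<phi> x \<le> c - d * indicator A x"
      using assms(1) by (simp add: AE_measure_pmf_iff)
    show "integrable (measure_pmf M) (\<lambda>x. c - d * indicator A x)"
      using int by simp
  qed
  also have "\<dots> = c - d * measure_pmf.prob M A"
    using int by (subst Bochner_Integration.integral_diff) auto
  finally show ?thesis .
qed

text \<open>Potential argument: weighting a state by 2 to the number of missing blocks, one round
  decreases the expected weight by a factor 1 - p / 2.\<close>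

lemma tester_accept_bound:
  assumes D: "set_pmf D \<subseteq> cube n" and p: "0 \<le> p" "p \<le> 1"
    and progress: "\<And>K Bs. K \<subseteq> graph n f \<Longrightarrow> certificate n K Bs \<Longrightarrow> length Bs \<le> k \<Longrightarrow>
       p \<le> measure_pmf.prob (round_pmf n m f D K Bs) {K'. growable n K' Bs}"
    and "K \<subseteq> graph n f" "certificate n K Bs"
  shows "pmf (verdict f D (tester n k m t K Bs)) True
    \<le> (if length Bs \<le> k then 2 ^ (Suc k - length Bs) * (1 - p / 2) ^ t else 0)"
  using assms(5,6)
proof (induction t arbitrary: K Bs)
  case (Suc t)
  show ?case
  proof (cases "length Bs \<le> k")
    case True
    define c where "c = 2 ^ (Suc k - length Bs) * (1 - p / 2) ^ t"
    have c0: "0 \<le> c"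
      using p by (simp add: c_def)
    let ?\<phi> = "\<lambda>K'. pmf (verdict f D (tester n k m t K' (grow n K' Bs))) True"
    have "?\<phi> K' \<le> c - c / 2 * indicator {K'. growable n K' Bs} K'"
      if "K' \<in> set_pmf (round_pmf n m f D K Bs)" for K'
    proof -
      note K' = set_round_pmf[OF D Suc.prems(1) that]
      have cert: "certificate n K' Bs"
        using certificate_mono[OF Suc.prems(2) K'(1)] .
      note IH = Suc.IH[OF K'(2) grow(1)[OF cert]]
      show ?thesis
      proof (cases "growable n K' Bs")
        case grows: True
        \<comment> \<open>One more block halves the weight; a block beyond \<open>k\<close> leads to
          certain rejection, which has weight 0.\<close>
        have "2 ^ (Suc k - length Bs) = 2 * (2 ^ (k - length Bs) :: real)"
          using True by (simp add: Suc_diff_le)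
        then show ?thesis
          using IH grows p by (auto simp: grow(2)[OF cert] c_def split: if_splits)
      next
        case False
        then show ?thesis
          using IH True by (simp add: grow(2)[OF cert] c_def)
      qed
    qed
    then have "measure_pmf.expectation (round_pmf n m f D K Bs) ?\<phi>
        \<le> c - c / 2 * measure_pmf.prob (round_pmf n m f D K Bs) {K'. growable n K' Bs}"
      by (rule expectation_le_affine_prob) (auto simp: pmf_le_1)
    also have "\<dots> \<le> c - c / 2 * p"
      using mult_left_mono[OF progress[OF Suc.prems True], of "c / 2"] c0 by simp
    also have "\<dots> = 2 ^ (Suc k - length Bs) * (1 - p / 2) ^ Suc t"
      by (simp add: c_def algebra_simps)
    finally show ?thesis
      using True by (simp add: verdict_round pmf_bind)
  qed simp
next
  case 0
  have "(1::real) \<le> 2 ^ (Suc k - length Bs)"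
    by simp
  then show ?case
    by (auto simp: pmf_le_1 intro: order_trans)
qed

subsection \<open>Progress in one round\<close>

lemma prob_bind_pmf:
  "measure_pmf.prob (bind_pmf M N) A = measure_pmf.expectation M (\<lambda>x. measure_pmf.prob (N x) A)"
proof -
  have eq: "measure_pmf.prob P A = pmf (map_pmf (\<lambda>x. x \<in> A) P) True" for P
    unfolding pmf_map by (rule arg_cong[where f = "measure_pmf.prob P"]) auto
  show ?thesis
    unfolding eq map_bind_pmf pmf_bind ..
qed

lemma expectation_mono:
  fixes M :: "'a pmf" and \<phi> \<psi> :: "'a \<Rightarrow> real"
  assumes "\<And>x. x \<in> set_pmf M \<Longrightarrow> \<phi> x \<le> \<psi> x"
    and "\<And>x. \<bar>\<phi> x\<bar> \<le> b" "\<And>x. \<bar>\<psi> x\<bar> \<le> b"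
  shows "measure_pmf.expectation M \<phi> \<le> measure_pmf.expectation M \<psi>"
proof (rule integral_mono_AE)
  show "integrable (measure_pmf M) \<phi>" "integrable (measure_pmf M) \<psi>"
    by (rule measure_pmf.integrable_const_bound[where B = b]; use assms(2,3) in simp)+
qed (use assms(1) in \<open>simp add: AE_measure_pmf_iff\<close>)

lemma prob_all_replicate_pmf:
  "measure_pmf.prob (replicate_pmf m M) {us. \<forall>u \<in> set us. Q u} = measure_pmf.prob M {u. Q u} ^ m"
proof (induction m)
  case (Suc m)
  have "measure_pmf.prob (replicate_pmf (Suc m) M) {us. \<forall>u \<in> set us. Q u}
      = measure_pmf.expectation M (\<lambda>u. measure_pmf.prob (replicate_pmf m M)
          ((\<lambda>us. u # us) -` {us. \<forall>u \<in> set us. Q u}))"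
    unfolding replicate_pmf.simps prob_bind_pmf[of M] map_pmf_def[symmetric] measure_map_pmf ..
  also have "\<dots> = measure_pmf.expectation M (\<lambda>u. indicator {u. Q u} u * measure_pmf.prob M {u. Q u} ^ m)"
    by (intro Bochner_Integration.integral_cong refl) (auto simp: Suc.IH[symmetric] vimage_def indicator_def)
  finally show ?case
    by simp
qed simp

section \<open>Juntas and rerandomisation\<close>

text \<open>A junta names exactly \<open>k\<close> indices, so \<open>I\<close> is first padded to a
  set \<open>J\<close> of that size; this is where \<open>k \<le> n\<close> enters.\<close>

lemma junta_if_depends_only_on:
  assumes I: "I \<subseteq> {..<n}" "card I \<le> k" "k \<le> n"
    and g: "\<And>x y. x \<in> cube n \<Longrightarrow> y \<in> cube n \<Longrightarrow> (\<And>i. i \<in> I \<Longrightarrow> x ! i = y ! i) \<Longrightarrow> g x = g y"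
  shows "junta n k g"
proof -
  obtain J where J: "I \<subseteq> J" "J \<subseteq> {..<n}" "card J = k"
    using exists_subset_between[of I k "{..<n}"] I by auto
  have fin: "finite J"
    using J(2) finite_subset by blast
  define js where "js = sorted_list_of_set J"
  have set_js: "set js = J"
    using fin by (simp add: js_def)
  define h where "h v \<longleftrightarrow> (\<exists>y \<in> cube n. map (\<lambda>i. y ! i) js = v \<and> g y)" for v
  have "g x = h (map (\<lambda>i. x ! i) js)" if x: "x \<in> cube n" for x
  proof
    show "h (map (\<lambda>i. x ! i) js)" if "g x"
      using that x unfolding h_def by blast
    assume "h (map (\<lambda>i. x ! i) js)"
    then obtain y where y: "y \<in> cube n" "map (\<lambda>i. y ! i) js = map (\<lambda>i. x ! i) js" "g y"
      unfolding h_def by blast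
    have "y ! i = x ! i" if "i \<in> I" for i
      using y(2) set_js J(1) that by auto
    with g[OF y(1) x] y(3) show "g x"
      by blast
  qed
  moreover have "sorted_wrt (<) js" "length js = k"
    using fin J(3) by (simp_all add: js_def)
  ultimately show ?thesis
    unfolding junta_def using set_js J(2) by blast
qed

text \<open>Compare \<open>f\<close> with the junta on \<open>I\<close> that takes the majority over all settings of the
  other variables.\<close>

lemma far_from_juntas_flip:
  assumes far: "far_from_juntas n k \<epsilon> D f" and D: "set_pmf D \<subseteq> cube n"
    and I: "I \<subseteq> {..<n}" "card I \<le> k" "k \<le> n"
  shows "\<epsilon> / 2 \<le> measure_pmf.expectation D (\<lambda>x. set_avg n (\<lambda>S. of_bool (f x \<noteq> f (flip n (S - I) x))))"
proof -
  define a where "a x = set_avg n (\<lambda>S. of_bool (f (flip n (S - I) x)))" for x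
  define g where "g x \<longleftrightarrow> a x > 1 / 2" for x
  have "junta n k g"
  proof (rule junta_if_depends_only_on[OF I])
    fix x y assume xy: "x \<in> cube n" "y \<in> cube n" "\<And>i. i \<in> I \<Longrightarrow> x ! i = y ! i"
    define C where "C = {i. i < n \<and> x ! i \<noteq> y ! i}"
    have C: "C \<subseteq> {..<n}" "C \<inter> I = {}"
      using xy(3) by (auto simp: C_def)
    have y: "y = flip n C x"
      using xy(1,2) by (intro nth_equalityI) (auto simp: cube_def flip_def C_def)
    have eq: "sym_diff (S - I) C = sym_diff S C - I" for S
      using C(2) by auto
    have "a y = a x"
      unfolding a_def y flip_flip eq
      by (rule set_avg_shift[OF C(1), where \<phi> = "\<lambda>S. of_bool (f (flip n (S - I) x))"])
    then show "g x = g y"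
      by (simp add: g_def)
  qed
  then have "\<epsilon> \<le> measure_pmf.prob D {x. f x \<noteq> g x}"
    using far by (simp add: far_from_juntas_def distance_def)
  also have "\<dots> = measure_pmf.expectation D (indicator {x. f x \<noteq> g x})"
    by simp
  also have "\<dots> \<le> measure_pmf.expectation D
      (\<lambda>x. 2 * set_avg n (\<lambda>S. of_bool (f x \<noteq> f (flip n (S - I) x))))"
  proof (rule expectation_mono[where b = 2])
    fix x
    have "0 \<le> set_avg n (\<lambda>S. of_bool (f x \<noteq> f (flip n (S - I) x)))"
      "set_avg n (\<lambda>S. of_bool (f x \<noteq> f (flip n (S - I) x))) \<le> 1"
      by (auto intro!: set_avg_nonneg set_avg_le_const)
    then show "\<bar>2 * set_avg n (\<lambda>S. of_bool (f x \<noteq> f (flip n (S - I) x)))\<bar> \<le> 2"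
      and "\<bar>indicator {x. f x \<noteq> g x} x :: real\<bar> \<le> 2"
      by (auto simp: indicator_def)
    \<comment> \<open>Where \<open>f\<close> and \<open>g\<close> disagree, \<open>f x\<close> is
      the minority value or there is a tie, so rerandomisation changes it with probability at least
      \<open>1 / 2\<close>.\<close>
    have "(if f x then 1 - a x else a x) = set_avg n (\<lambda>S. of_bool (f x \<noteq> f (flip n (S - I) x)))"
      using set_avg_of_bool_not[of n "\<lambda>S. f (flip n (S - I) x)"] by (auto simp: a_def)
    moreover have "0 \<le> a x" "a x \<le> 1"
      unfolding a_def by (auto intro!: set_avg_nonneg set_avg_le_const)
    ultimately show "indicator {x. f x \<noteq> g x} x
        \<le> 2 * set_avg n (\<lambda>S. of_bool (f x \<noteq> f (flip n (S - I) x)))"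
      by (auto simp: g_def indicator_def split: if_splits)
  qed
  finally show ?thesis
    by simp
qed

text \<open>Split \<open>S\<close> into its part off the dictators and its trace \<open>J\<close> on
  them. The complemented blocks depend on \<open>J\<close> alone, so off the dictators the pivot is
  a uniform set shifted by a fixed one, while complementation removes every dictator. Thus pivoting
  rerandomises exactly the other variables.\<close>

lemma set_avg_pivot:
  assumes disj: "sorted_wrt (\<lambda>A B. A \<inter> B = {}) Bs" and Bs: "\<And>B. B \<in> set Bs \<Longrightarrow> \<tau> B \<in> B \<and> B \<subseteq> {..<n}"
  shows "set_avg n (\<lambda>S. \<phi> (sym_diff S (\<Union>{B \<in> set Bs. \<tau> B \<in> S}))) = set_avg n (\<lambda>S. \<phi> (S - \<tau> ` set Bs))"
proof -
  define I where "I = \<tau> ` set Bs"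
  define P where "P S = sym_diff S (\<Union>{B \<in> set Bs. \<tau> B \<in> S})" for S
  define C where "C J = \<Union>{B \<in> set Bs. \<tau> B \<in> J}" for J
  have sep: "B = B'" if "B \<in> set Bs" "B' \<in> set Bs" "\<tau> B \<in> B'" for B B'
    using sorted_wrt_disjointD[OF disj that(1,2)] Bs[OF that(1)] that(3) by auto
  have P_mix: "P ((S - I) \<union> (J \<inter> I)) = sym_diff S (C J) - I" for S J
  proof -
    have "\<tau> B \<in> (S - I) \<union> (J \<inter> I) \<longleftrightarrow> \<tau> B \<in> J" if "B \<in> set Bs" for B
      using that by (auto simp: I_def)
    then have "P ((S - I) \<union> (J \<inter> I)) = sym_diff ((S - I) \<union> (J \<inter> I)) (C J)"
      unfolding P_def C_def by (metis (mono_tags, lifting) Collect_cong)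
    \<comment> \<open>A dictator lies in no block but its own, so it is complemented exactly when it
      is in \<open>J\<close>.\<close>
    moreover have "i \<in> J \<longleftrightarrow> i \<in> C J" if i: "i \<in> I" for i
    proof -
      obtain B where B: "B \<in> set Bs" "i = \<tau> B"
        using i by (auto simp: I_def)
      show ?thesis
      proof
        assume "i \<in> J"
        then show "i \<in> C J"
          using B Bs[OF B(1)] by (auto simp: C_def)
      next
        assume "i \<in> C J"
        then obtain B' where "B' \<in> set Bs" "\<tau> B' \<in> J" "i \<in> B'"
          by (auto simp: C_def)
        then show "i \<in> J"
          using sep[OF B(1), of B'] B(2) by simp
      qed
    qed
    then have "sym_diff ((S - I) \<union> (J \<inter> I)) (C J) = sym_diff S (C J) - I"
      by blast
    ultimately show ?thesis
      by simp
  qed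
  have C_sub: "C J \<subseteq> {..<n}" for J
    using Bs by (auto simp: C_def)
  have "set_avg n (\<lambda>S. \<phi> (P S)) = set_avg n (\<lambda>S. set_avg n (\<lambda>J. \<phi> (P ((S - I) \<union> (J \<inter> I)))))"
    by (rule set_avg_mix[symmetric])
  also have "\<dots> = set_avg n (\<lambda>J. set_avg n (\<lambda>S. \<phi> (sym_diff S (C J) - I)))"
    unfolding P_mix by (rule set_avg_swap)
  also have "\<dots> = set_avg n (\<lambda>J. set_avg n (\<lambda>S. \<phi> (S - I)))"
    by (intro set_avg_cong set_avg_shift[OF C_sub, where \<phi> = "\<lambda>S. \<phi> (S - I)"])
  finally show ?thesis
    by (simp add: P_def I_def)
qed

lemma witness:
  assumes "relevant n K B" "K \<subseteq> graph n f"
  shows "witness n K B \<in> cube n" "f (witness n K B) \<noteq> f (flip n B (witness n K B))"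
proof -
  have "\<exists>z b. (z, b) \<in> K \<and> (flip n B z, \<not> b) \<in> K"
    using assms(1) by (simp add: relevant_def)
  then have "\<exists>b. (witness n K B, b) \<in> K \<and> (flip n B (witness n K B), \<not> b) \<in> K"
    unfolding witness_def by (rule someI_ex)
  then obtain b where "(witness n K B, b) \<in> graph n f" "(flip n B (witness n K B), \<not> b) \<in> graph n f"
    using assms(2) by blast
  then show "witness n K B \<in> cube n" "f (witness n K B) \<noteq> f (flip n B (witness n K B))"
    by (auto simp: mem_graph)
qed

lemma probed_probe_transcript:
  assumes "B \<in> set Bs" "U \<in> set Us" "X \<in> range (venn n S R U)"
  shows "probed n f (probe_transcript n f K Bs x S R Us) B (witness n K B) X"
  using assms unfolding probed_def probe_transcript_def probes_def
  by (auto simp: UNIV_enum[symmetric] intro!: image_eqI[OF refl])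

lemma prob_round:
  "measure_pmf.prob (round_pmf n m f D K Bs) {K'. Q K'} =
     measure_pmf.expectation D (\<lambda>x. set_avg n (\<lambda>S. set_avg n (\<lambda>R. set_avg n (\<lambda>U.
       measure_pmf.prob (replicate_pmf m (pmf_of_set (Pow {..<n})))
         {Us. Q (next_transcript n f K Bs x S R (U # Us))}))))"
  unfolding round_pmf_def prob_bind_pmf expectation_random_set measure_map_pmf vimage_def by simp

text \<open>If some block fails the dictator test with probability above \<open>1 / 100\<close>,
  those failures alone suffice. Otherwise every block has a dictator, all votes succeed with
  probability at least \<open>1 / 2\<close> for each fixed \<open>S\<close>, and the pivot changes
  \<open>f x\<close> with probability at least \<open>\<epsilon> / 2\<close>; the product
  \<open>\<epsilon> / 4\<close> exceeds the bound.\<close>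

lemma round_progress:
  assumes D: "set_pmf D \<subseteq> cube n" and far: "far_from_juntas n k \<epsilon> D f"
    and k: "k \<le> n" and \<epsilon>: "0 < \<epsilon>" "\<epsilon> \<le> 1" and m: "real k * (1 / 2) ^ m \<le> 1 / 2"
    and K: "K \<subseteq> graph n f" and cert: "certificate n K Bs" and len: "length Bs \<le> k"
  shows "\<epsilon> / 100 \<le> measure_pmf.prob (round_pmf n m f D K Bs) {K'. growable n K' Bs}"
proof -
  define w where "w = witness n K"
  define F where "F B = block_fun n f B (w B)" for B
  define draws where "draws = replicate_pmf m (pmf_of_set (Pow {..<n}))"
  define win where "win x S R U = measure_pmf.prob draws
    {Us. growable n (next_transcript n f K Bs x S R (U # Us)) Bs}" for x S R U
  have disj: "sorted_wrt (\<lambda>A B. A \<inter> B = {}) Bs" and BN: "\<And>B. B \<in> set Bs \<Longrightarrow> B \<subseteq> {..<n}"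
    using cert by (auto simp: certificate_def)
  have w: "w B \<in> cube n" "f (w B) \<noteq> f (flip n B (w B))" if "B \<in> set Bs" for B
    using witness[of n K B f] that cert K by (auto simp: certificate_def w_def)
  have win01: "0 \<le> win x S R U" "win x S R U \<le> 1" for x S R U
    by (simp_all add: win_def)
  have prob: "measure_pmf.prob (round_pmf n m f D K Bs) {K'. growable n K' Bs} =
      measure_pmf.expectation D (\<lambda>x. set_avg n (\<lambda>S. set_avg n (\<lambda>R. set_avg n (win x S R))))"
    unfolding prob_round win_def draws_def ..
  have win_abs: "\<bar>set_avg n (\<lambda>S. set_avg n (\<lambda>R. set_avg n (win x S R)))\<bar> \<le> 1" for x
    using win01 by (auto simp: abs_le_iff intro!: set_avg_le_const set_avg_nonneg order_trans[OF _ set_avg_nonneg])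
  have cert1: "certificate n (probe_transcript n f K Bs x S R Us) Bs" if "x \<in> cube n" for x S R Us
    using certificate_mono[OF cert next_transcript_bounds(1)[OF that K]] .
  show ?thesis
  proof (cases "\<exists>B \<in> set Bs. set_avg n (\<lambda>S. set_avg n (\<lambda>R. set_avg n (\<lambda>U.
      of_bool (\<not> dictator_like n (F B) S R U)))) > 1 / 100")
    case True
    then obtain B where B: "B \<in> set Bs" and large:
      "set_avg n (\<lambda>S. set_avg n (\<lambda>R. set_avg n (\<lambda>U. of_bool (\<not> dictator_like n (F B) S R U)))) > 1 / 100"
      by blast
    have "1 / 100 \<le> set_avg n (\<lambda>S. set_avg n (\<lambda>R. set_avg n (win x S R)))" if x: "x \<in> cube n" for x
    proof (rule order_trans[OF less_imp_le[OF large]], intro set_avg_mono)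
      fix S R U :: "nat set"
      assume sub: "S \<subseteq> {..<n}" "R \<subseteq> {..<n}" "U \<subseteq> {..<n}"
      have "growable n (next_transcript n f K Bs x S R (U # Us)) Bs"
        if "\<not> dictator_like n (F B) S R U" for Us
      proof (rule growable_mono[OF _ next_transcript_bounds(2)[OF x K]])
        have "probed n f (probe_transcript n f K Bs x S R (U # Us)) B (w B) X"
          if "X \<in> range (venn n S R U)" for X
          unfolding w_def by (rule probed_probe_transcript[OF B _ that]) simp
        then show "growable n (probe_transcript n f K Bs x S R (U # Us)) Bs"
          by (rule growable_if_not_dictator_like[OF cert1[OF x] B w[OF B] sub _ that[unfolded F_def]])
      qed
      then have "win x S R U = 1" if "\<not> dictator_like n (F B) S R U"
        using that by (simp add: win_def)
      then show "of_bool (\<not> dictator_like n (F B) S R U) \<le> win x S R U"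
        using win01 by auto
    qed
    then have "measure_pmf.expectation D (\<lambda>x. 1 / 100) \<le>
        measure_pmf.expectation D (\<lambda>x. set_avg n (\<lambda>S. set_avg n (\<lambda>R. set_avg n (win x S R))))"
      using D win_abs by (intro expectation_mono[where b = 1]) auto
    then show ?thesis
      using \<epsilon> by (simp add: prob)
  next
    case False
    have "\<exists>z. z < n \<and> (\<forall>A. A \<subseteq> {..<n} \<longrightarrow> z \<in> A \<longrightarrow>
        set_avg n (\<lambda>X. of_bool (F B X = F B (sym_diff X A))) \<le> 1 / 2)" if "B \<in> set Bs" for B
    proof -
      have "set_avg n (\<lambda>S. set_avg n (\<lambda>R. set_avg n (\<lambda>U. of_bool (\<not> dictator_like n (F B) S R U)))) \<le> 1 / 100"
        using False that by (auto simp: not_less)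
      from near_dictator[OF this] show ?thesis
        by metis
    qed
    then have "\<forall>B \<in> set Bs. \<exists>z. z < n \<and> (\<forall>A. A \<subseteq> {..<n} \<longrightarrow> z \<in> A \<longrightarrow>
        set_avg n (\<lambda>X. of_bool (F B X = F B (sym_diff X A))) \<le> 1 / 2)"
      by blast
    from bchoice[OF this] obtain \<tau> where \<tau>: "\<And>B. B \<in> set Bs \<Longrightarrow> \<tau> B < n"
      and dict: "\<And>B A. B \<in> set Bs \<Longrightarrow> A \<subseteq> {..<n} \<Longrightarrow> \<tau> B \<in> A \<Longrightarrow>
        set_avg n (\<lambda>X. of_bool (F B X = F B (sym_diff X A))) \<le> 1 / 2"
      by blast
    \<comment> \<open>A variable off \<open>B\<close> has no effect on \<open>F B\<close>, so the
      average in \<open>dict\<close> would be 1 for its singleton.\<close>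
    have \<tau>_mem: "\<tau> B \<in> B" if B: "B \<in> set Bs" for B
    proof (rule ccontr)
      assume "\<tau> B \<notin> B"
      then have "sym_diff X {\<tau> B} \<inter> B = X \<inter> B" for X
        by auto
      then have "F B X = F B (sym_diff X {\<tau> B})" for X
        by (simp add: F_def block_fun_def)
      then show False
        using dict[OF B, of "{\<tau> B}"] \<tau>[OF B] by simp
    qed
    \<comment> \<open>\<open>side\<close> is whichever of \<open>S\<close> and its complement
      contains the dictator. Shifting a random \<open>U\<close> by it changes \<open>F B\<close>
      with probability at least \<open>1 / 2\<close>, and one change among the \<open>m\<close>
      draws settles the vote.\<close>
    define side where "side B S = (if \<tau> B \<in> S then S else sym_diff S {..<n})" for B S
    define votes where "votes S Us \<longleftrightarrow>
      (\<forall>B \<in> set Bs. \<exists>U \<in> set Us. F B U \<noteq> F B (sym_diff U (side B S)))" for S Us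
    define P where "P S = sym_diff S (\<Union>{B \<in> set Bs. \<tau> B \<in> S})" for S
    have prob_votes: "1 / 2 \<le> measure_pmf.prob draws {Us. votes S Us}" if S: "S \<subseteq> {..<n}" for S
    proof -
      \<comment> \<open>Union bound over at most \<open>k\<close> blocks, each missed by all
        \<open>m\<close> independent draws with probability at most
        \<open>(1 / 2) ^ m\<close>.\<close>
      have "measure_pmf.prob draws {Us. \<not> votes S Us}
          \<le> measure_pmf.prob draws (\<Union>B \<in> set Bs. {Us. \<forall>U \<in> set Us. F B U = F B (sym_diff U (side B S))})"
        by (intro measure_pmf.finite_measure_mono) (auto simp: votes_def)
      also have "\<dots> \<le> (\<Sum>B \<in> set Bs. measure_pmf.prob draws
          {Us. \<forall>U \<in> set Us. F B U = F B (sym_diff U (side B S))})"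
        by (intro measure_pmf.finite_measure_subadditive_finite) auto
      also have "\<dots> \<le> (\<Sum>B \<in> set Bs. (1 / 2) ^ m)"
      proof (rule sum_mono)
        fix B assume B: "B \<in> set Bs"
        have "side B S \<subseteq> {..<n}" "\<tau> B \<in> side B S"
          using S \<tau>[OF B] by (auto simp: side_def)
        from dict[OF B this] show "measure_pmf.prob draws
          {Us. \<forall>U \<in> set Us. F B U = F B (sym_diff U (side B S))} \<le> (1 / 2) ^ m"
          unfolding draws_def prob_all_replicate_pmf prob_random_set
          by (intro power_mono set_avg_nonneg) auto
      qed
      also have "\<dots> \<le> real k * (1 / 2) ^ m"
      proof -
        have "card (set Bs) \<le> k"
          using len card_length[of Bs] by simp
        then show ?thesis
          by (simp add: mult_right_mono)
      qed
      finally have "measure_pmf.prob draws {Us. \<not> votes S Us} \<le> 1 / 2"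
        using m by simp
      moreover have "measure_pmf.prob draws {Us. \<not> votes S Us} = 1 - measure_pmf.prob draws {Us. votes S Us}"
        using measure_pmf.prob_compl[of "{Us. votes S Us}" draws]
        by (simp add: Compl_eq_Diff_UNIV[symmetric] Collect_neg_eq)
      ultimately show ?thesis
        by simp
    qed
    have grows: "growable n (next_transcript n f K Bs x S R (U # Us)) Bs"
      if x: "x \<in> cube n" and sub: "S \<subseteq> {..<n}" "R \<subseteq> {..<n}" "U \<subseteq> {..<n}"
        and Us: "Us \<in> set_pmf draws" and votes: "votes S Us" and change: "f x \<noteq> f (flip n (P S) x)"
      for x S R U Us
    proof (cases "growable n (probe_transcript n f K Bs x S R (U # Us)) Bs")
      case True
      then show ?thesis
        using growable_mono next_transcript_bounds(2)[OF x K] by blast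
    next
      \<comment> \<open>The pivot is computed before the hybrids are asked. As the probes alone give
        no growth, the votes force it to be \<open>P S\<close>.\<close>
      case stuck: False
      let ?K1 = "probe_transcript n f K Bs x S R (U # Us)"
      have probed: "probed n f ?K1 B (w B) X"
        if "B \<in> set Bs" "V \<in> set (U # Us)" "X \<in> range (venn n S R V)" for B V X
        unfolding w_def using that by (rule probed_probe_transcript)
      have UsN: "V \<subseteq> {..<n}" if "V \<in> set Us" for V
      proof -
        have "set_pmf (pmf_of_set (Pow {..<n})) = Pow {..<n}"
          by (rule set_pmf_of_set) auto
        then show ?thesis
          using Us that by (auto simp: draws_def set_replicate_pmf)
      qed
      have "relevant n ?K1 (side B S \<inter> B)" if B: "B \<in> set Bs" for B
      proof -
        obtain V where V: "V \<in> set Us" "F B V \<noteq> F B (sym_diff V (side B S))"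
          using votes B by (auto simp: votes_def)
        note gen = range_venn_generators[OF sub(1,2) UsN[OF V(1)]]
        have "side B S \<in> range (venn n S R V)"
          using gen range_venn_ops by (auto simp: side_def)
        then have mem: "sym_diff V (side B S) \<in> range (venn n S R V)"
          using gen(5) range_venn_ops(1) by blast
        have VUs: "V \<in> set (U # Us)"
          using V(1) by simp
        show ?thesis
          by (rule relevant_probed[OF probed[OF B VUs gen(5)] probed[OF B VUs mem] V(2)[unfolded F_def]])
      qed
      then have pivot: "pivot n ?K1 Bs S = P S"
        unfolding P_def side_def by (rule pivot_eq[OF cert1[OF x] stuck])
      show ?thesis
      proof (rule growable_if_pivot_changes[OF cert1[OF x] sub(1) next_transcript_bounds(2)[OF x K],
            where w = w and f = f])
        show "w B \<in> cube n \<and> f (w B) \<noteq> f (flip n B (w B))" if "B \<in> set Bs" for B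
          using w[OF that] by blast
        show "probed n f ?K1 B (w B) X" if "B \<in> set Bs" "X \<in> {{}, {..<n}, S}" for B X
          using that range_venn_generators[OF sub] by (intro probed[of B U]) auto
        show "(x, f x) \<in> next_transcript n f K Bs x S R (U # Us)"
          by (simp add: next_transcript_def probe_transcript_def)
        show "f x \<noteq> f (flip n (pivot n ?K1 Bs S) x)"
          unfolding pivot by (rule change)
        show "(hybrid n Bs (pivot n ?K1 Bs S) x j, f (hybrid n Bs (pivot n ?K1 Bs S) x j))
            \<in> next_transcript n f K Bs x S R (U # Us)" if "j \<le> length Bs" for j
          using that by (auto simp: next_transcript_def hybrids_def simp del: upt_Suc)
      qed
    qed
    have lower: "1 / 2 * set_avg n (\<lambda>S. of_bool (f x \<noteq> f (flip n (S - \<tau> ` set Bs) x)))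
        \<le> set_avg n (\<lambda>S. set_avg n (\<lambda>R. set_avg n (win x S R)))" if x: "x \<in> cube n" for x
    proof -
      have "1 / 2 * set_avg n (\<lambda>S. of_bool (f x \<noteq> f (flip n (S - \<tau> ` set Bs) x)))
          = set_avg n (\<lambda>S. 1 / 2 * of_bool (f x \<noteq> f (flip n (P S) x)))"
        unfolding set_avg_cmult P_def
        using \<tau>_mem BN
        by (subst set_avg_pivot[OF disj, where \<phi> = "\<lambda>A. of_bool (f x \<noteq> f (flip n A x))"]) auto
      also have "\<dots> \<le> set_avg n (\<lambda>S. set_avg n (\<lambda>R. set_avg n (win x S R)))"
      proof (intro set_avg_mono set_avg_ge_const)
        fix S R U :: "nat set"
        assume sub: "S \<subseteq> {..<n}" "R \<subseteq> {..<n}" "U \<subseteq> {..<n}"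
        \<comment> \<open>Whether flipping \<open>P S\<close> changes \<open>f x\<close> depends on
          \<open>x\<close> and \<open>S\<close> only, and the vote bound holds for every
          \<open>S\<close>, so the two bounds multiply.\<close>
        have "measure_pmf.prob draws {Us. votes S Us} \<le> win x S R U" if "f x \<noteq> f (flip n (P S) x)"
          unfolding win_def using grows[OF x sub _ _ that]
          by (intro measure_pmf.finite_measure_mono_AE) (auto simp: AE_measure_pmf_iff)
        then show "1 / 2 * of_bool (f x \<noteq> f (flip n (P S) x)) \<le> win x S R U"
          using prob_votes[OF sub(1)] win01[of x S R U] by (cases "f x = f (flip n (P S) x)") auto
      qed
      finally show ?thesis .
    qed
    have card: "card (\<tau> ` set Bs) \<le> k"
      using len card_length[of Bs] card_image_le[of "set Bs" \<tau>] by simp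
    have "\<epsilon> / 100 \<le> 1 / 2 * (\<epsilon> / 2)"
      using \<epsilon> by simp
    also have "\<dots> \<le> 1 / 2 * measure_pmf.expectation D (\<lambda>x. set_avg n (\<lambda>S.
        of_bool (f x \<noteq> f (flip n (S - \<tau> ` set Bs) x))))"
      using far_from_juntas_flip[OF far D _ card k] \<tau> by (intro mult_left_mono) auto
    also have "\<dots> = measure_pmf.expectation D (\<lambda>x. 1 / 2 * set_avg n (\<lambda>S.
        of_bool (f x \<noteq> f (flip n (S - \<tau> ` set Bs) x))))"
      by simp
    also have "\<dots> \<le> measure_pmf.expectation D (\<lambda>x. set_avg n (\<lambda>S. set_avg n (\<lambda>R. set_avg n (win x S R))))"
    proof (rule expectation_mono[where b = 1])
      fix x
      have "0 \<le> set_avg n (\<lambda>S. of_bool (f x \<noteq> f (flip n (S - \<tau> ` set Bs) x)))"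
        "set_avg n (\<lambda>S. of_bool (f x \<noteq> f (flip n (S - \<tau> ` set Bs) x))) \<le> 1"
        by (auto intro!: set_avg_nonneg set_avg_le_const)
      then show "\<bar>1 / 2 * set_avg n (\<lambda>S. of_bool (f x \<noteq> f (flip n (S - \<tau> ` set Bs) x)))\<bar> \<le> 1"
        by (auto simp: abs_le_iff)
    qed (use lower D win_abs in auto)
    finally show ?thesis
      unfolding prob .
  qed
qed

subsection \<open>Choice of parameters\<close>

definition vote_count :: "nat \<Rightarrow> nat" where
  "vote_count k = nat \<lceil>log 2 (2 * real k)\<rceil>"

text \<open>Each round shrinks the weight by \<open>1 - \<epsilon> / 200\<close>, which is at most
  \<open>exp (- (\<epsilon> / 200))\<close>. This many rounds give at most
  \<open>exp (- (k + 3))\<close>, which beats the initial weight \<open>2 ^ Suc k\<close> by a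
  factor of at least \<open>exp 2\<close>, hence of at least 3.\<close>

definition round_count :: "nat \<Rightarrow> real \<Rightarrow> nat" where
  "round_count k \<epsilon> = nat \<lceil>200 * (real k + 3) / \<epsilon>\<rceil>"

text \<open>Rounds times cost per round, with \<open>1 / \<epsilon>\<close> taken out. The
  \<open>+ 1\<close> absorbs rounding up the round count, using \<open>\<epsilon> \<le> 1\<close>;
  the \<open>+ 2\<close> next to the logarithm is one for rounding and one for the extra set
  \<open>U\<close>.\<close>

definition budget :: "nat \<Rightarrow> real" where
  "budget k = (200 * (real k + 3) + 1) * (real k * ((log 2 (2 * real k) + 2) * 256) + real k + 2)"

lemma vote_count:
  assumes "k > 0"
  shows "real k * (1 / 2) ^ vote_count k \<le> 1 / 2" "real (vote_count k) \<le> log 2 (2 * real k) + 1"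
proof -
  have pos: "0 \<le> log 2 (2 * real k)"
    using assms by simp
  then have "log 2 (2 * real k) \<le> real (vote_count k)"
    unfolding vote_count_def by linarith
  then have "2 * real k \<le> 2 powr real (vote_count k)"
    using assms by (subst (asm) log_le_iff) auto
  then have "2 * real k \<le> 2 ^ vote_count k"
    by (simp add: powr_realpow)
  then show "real k * (1 / 2) ^ vote_count k \<le> 1 / 2"
    by (simp add: power_one_over field_simps)
  show "real (vote_count k) \<le> log 2 (2 * real k) + 1"
    using pos unfolding vote_count_def by linarith
qed

lemma budget_soft_O: "budget \<in> soft_O (\<lambda>k. real k ^ 2)"
proof -
  have "budget \<in> O(\<lambda>k. real k ^ 2 * ln (real k ^ 2) ^ 1)"
    unfolding budget_def[abs_def] log_def by real_asymp
  then show ?thesis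
    unfolding soft_O_def by blast
qed

lemma tester_cost:
  assumes k: "k > 0" and \<epsilon>: "0 < \<epsilon>" "\<epsilon> \<le> 1"
  shows "ereal_of_enat (query_complexity n (tester n k (vote_count k) (round_count k \<epsilon>) {} []))
    \<le> ereal (budget k / \<epsilon>)"
proof -
  define q where "q = round_count k \<epsilon> * (k * (Suc (vote_count k) * 256) + k + 2)"
  have "0 \<le> 200 * (real k + 3) / \<epsilon>"
    using \<epsilon> by simp
  then have "real (round_count k \<epsilon>) \<le> 200 * (real k + 3) / \<epsilon> + 1"
    unfolding round_count_def by linarith
  also have "\<dots> \<le> (200 * (real k + 3) + 1) / \<epsilon>"
    using \<epsilon> by (simp add: field_simps)
  finally have rounds: "real (round_count k \<epsilon>) \<le> (200 * (real k + 3) + 1) / \<epsilon>" .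
  have "real q \<le> (200 * (real k + 3) + 1) / \<epsilon> *
      (real k * ((log 2 (2 * real k) + 2) * 256) + real k + 2)"
    unfolding q_def of_nat_mult
  proof (rule mult_mono[OF rounds])
    have "real k * (real (Suc (vote_count k)) * 256) \<le> real k * ((log 2 (2 * real k) + 2) * 256)"
      using vote_count(2)[OF k] by (intro mult_left_mono) auto
    then show "real (k * (Suc (vote_count k) * 256) + k + 2)
        \<le> real k * ((log 2 (2 * real k) + 2) * 256) + real k + 2"
      by simp
  qed (use \<epsilon> in auto)
  also have "\<dots> = budget k / \<epsilon>"
    by (simp add: budget_def)
  finally have q: "real q \<le> budget k / \<epsilon>" .
  have "query_complexity n (tester n k (vote_count k) (round_count k \<epsilon>) {} []) \<le> enat q"
    unfolding q_def by (intro query_complexity_le costs_at_most_tester)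
  then have "ereal_of_enat (query_complexity n (tester n k (vote_count k) (round_count k \<epsilon>) {} []))
      \<le> ereal_of_enat (enat q)"
    by (simp only: ereal_of_enat_le_iff)
  also have "\<dots> \<le> ereal (budget k / \<epsilon>)"
    using q by simp
  finally show ?thesis .
qed

lemma certificate_Nil: "certificate n {} []"
  by (simp add: certificate_def)

lemma tester_one_sided: "one_sided n k (tester n k m t {} [])"
  unfolding one_sided_def
proof (intro allI impI)
  fix f D
  assume "set_pmf D \<subseteq> cube n" "junta n k f"
  then have "set_pmf (verdict f D (tester n k m t {} [])) \<subseteq> {True}"
    by (rule tester_accepts_junta) (simp_all add: certificate_Nil)
  then have "verdict f D (tester n k m t {} []) = return_pmf True"
    by (simp add: set_pmf_subset_singleton)
  then show "prob_accept f D (tester n k m t {} []) = 1"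
    by (simp add: prob_accept_verdict)
qed

lemma tester_rejects_far:
  assumes D: "set_pmf D \<subseteq> cube n" and far: "far_from_juntas n k \<epsilon> D f"
    and k: "0 < k" "k \<le> n" and \<epsilon>: "0 < \<epsilon>" "\<epsilon> \<le> 1"
  shows "2 / 3 \<le> prob_reject f D (tester n k (vote_count k) (round_count k \<epsilon>) {} [])"
proof -
  let ?t = "round_count k \<epsilon>"
  have p: "0 \<le> \<epsilon> / 100" "\<epsilon> / 100 \<le> 1"
    using \<epsilon> by simp_all
  have "prob_accept f D (tester n k (vote_count k) ?t {} [])
      \<le> 2 ^ Suc k * (1 - \<epsilon> / 100 / 2) ^ ?t"
  proof -
    have "pmf (verdict f D (tester n k (vote_count k) ?t {} [])) True
        \<le> (if length ([] :: nat set list) \<le> k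
            then 2 ^ (Suc k - length ([] :: nat set list)) * (1 - \<epsilon> / 100 / 2) ^ ?t else 0)"
      by (intro tester_accept_bound[OF D p] round_progress[OF D far k(2) \<epsilon> vote_count(1)[OF k(1)]])
         (simp_all add: certificate_Nil)
    then show ?thesis
      by (simp add: prob_accept_verdict)
  qed
  also have "\<dots> \<le> exp (real (Suc k)) * exp (- (real k + 3))"
  proof (rule mult_mono)
    have "2 ^ Suc k \<le> exp (1::real) ^ Suc k"
      using exp_ge_add_one_self[of 1] by (intro power_mono) auto
    then show "2 ^ Suc k \<le> exp (real (Suc k))"
      using exp_of_nat_mult[of "Suc k" "1::real"] by simp
    have "(1 - \<epsilon> / 100 / 2) ^ ?t \<le> exp (- (\<epsilon> / 200)) ^ ?t"
      using \<epsilon> exp_ge_add_one_self[of "- (\<epsilon> / 200)"] by (intro power_mono) auto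
    also have "\<dots> = exp (- (\<epsilon> / 200 * real ?t))"
      using exp_of_nat_mult[of ?t "- (\<epsilon> / 200)"] by (simp add: mult.commute)
    also have "\<dots> \<le> exp (- (real k + 3))"
    proof -
      have "200 * (real k + 3) / \<epsilon> \<le> real ?t"
        unfolding round_count_def by (rule real_nat_ceiling_ge)
      then show ?thesis
        using \<epsilon> by (simp add: field_simps)
    qed
    finally show "(1 - \<epsilon> / 100 / 2) ^ ?t \<le> exp (- (real k + 3))" .
  qed (use \<epsilon> in auto)
  also have "\<dots> = 1 / exp 2"
    by (simp add: exp_add[symmetric] exp_minus field_simps)
  also have "\<dots> \<le> 1 / 3"
    using exp_ge_add_one_self[of 2] by (simp add: frac_le)
  finally show ?thesis
    by (simp add: prob_reject_eq)
qed

lemma no_junta: "n < k \<Longrightarrow> \<not> junta n k f"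
proof
  assume "n < k" "junta n k f"
  then obtain js where js: "length js = k" "sorted_wrt (<) js" "set js \<subseteq> {..<n}"
    unfolding junta_def by blast
  have "distinct js"
    using js(2) by (simp add: strict_sorted_iff)
  then have "k = card (set js)"
    using js(1) by (simp add: distinct_card)
  also have "\<dots> \<le> n"
    using card_mono[OF _ js(3)] by simp
  finally show False
    using \<open>n < k\<close> by simp
qed

lemma not_far_from_juntas:
  assumes "k \<le> n" "1 < \<epsilon>"
  shows "\<not> far_from_juntas n k \<epsilon> D f"
proof
  assume "far_from_juntas n k \<epsilon> D f"
  moreover have "junta n k (\<lambda>_. True)"
    using assms by (intro junta_if_depends_only_on[where I = "{}"]) auto
  ultimately have "\<epsilon> \<le> distance D f (\<lambda>_. True)"
    by (simp add: far_from_juntas_def)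
  also have "\<dots> \<le> 1"
    by (simp add: distance_def)
  finally show False
    using assms by simp
qed

lemma Verdict_properties:
  "prob_accept f D (Verdict b) = of_bool b" "prob_reject f D (Verdict b) = of_bool (\<not> b)"
  by (auto simp: prob_reject_eq prob_accept_verdict)

lemma query_complexity_Verdict: "query_complexity n (Verdict b) = 0"
  using query_complexity_le[of "Verdict b" 0 n] by (simp add: zero_enat_def[symmetric])

text \<open>For \<open>n < k\<close> there is no junta, so rejecting is right and vacuously
  one-sided. For \<open>k \<le> n\<close> and \<open>\<epsilon> > 1\<close> nothing is far, because
  a constant is a junta at distance at most 1. The remaining range is the one that
  \<open>round_progress\<close> covers.\<close>

definition junta_tester :: "nat \<Rightarrow> real \<Rightarrow> nat \<Rightarrow> oracle_alg" where
  "junta_tester k \<epsilon> n = (if n < k then Verdict False else if 1 < \<epsilon> then Verdict True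
     else tester n k (vote_count k) (round_count k \<epsilon>) {} [])"

lemma budget_nonneg: "0 < k \<Longrightarrow> 0 \<le> budget k"
  by (auto simp: budget_def intro!: mult_nonneg_nonneg add_nonneg_nonneg)

theorem theorem1:
  "\<exists>T \<in> soft_O (\<lambda>k. real k ^ 2).
     \<forall>k::nat. \<forall>\<epsilon>::real. k > 0 \<longrightarrow> \<epsilon> > 0 \<longrightarrow>
       (\<exists>A :: nat \<Rightarrow> oracle_alg. \<forall>n.
          distribution_free_junta_tester n k \<epsilon> (A n) \<and>
          one_sided n k (A n) \<and>
          ereal_of_enat (query_complexity n (A n)) \<le> ereal (T k / \<epsilon>))"
proof (intro bexI[OF _ budget_soft_O] allI impI)
  fix k :: nat and \<epsilon> :: real
  assume k: "0 < k" and \<epsilon>: "0 < \<epsilon>"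
  show "\<exists>A. \<forall>n. distribution_free_junta_tester n k \<epsilon> (A n) \<and> one_sided n k (A n) \<and>
      ereal_of_enat (query_complexity n (A n)) \<le> ereal (budget k / \<epsilon>)"
  proof (intro exI[of _ "junta_tester k \<epsilon>"] allI)
    fix n
    have budget: "0 \<le> budget k / \<epsilon>"
      using budget_nonneg[OF k] \<epsilon> by simp
    consider "n < k" | "k \<le> n" "1 < \<epsilon>" | "k \<le> n" "\<epsilon> \<le> 1"
      by linarith
    then show "distribution_free_junta_tester n k \<epsilon> (junta_tester k \<epsilon> n) \<and>
        one_sided n k (junta_tester k \<epsilon> n) \<and>
        ereal_of_enat (query_complexity n (junta_tester k \<epsilon> n)) \<le> ereal (budget k / \<epsilon>)"
    proof cases
      case 1
      then show ?thesis
        using no_junta[OF 1] budget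
        by (simp add: junta_tester_def distribution_free_junta_tester_def one_sided_def
            Verdict_properties query_complexity_Verdict)
    next
      case 2
      then show ?thesis
        using not_far_from_juntas[OF 2] budget
        by (simp add: junta_tester_def distribution_free_junta_tester_def one_sided_def
            Verdict_properties query_complexity_Verdict)
    next
      case 3
      have A: "junta_tester k \<epsilon> n = tester n k (vote_count k) (round_count k \<epsilon>) {} []"
        using 3 by (simp add: junta_tester_def)
      have "distribution_free_junta_tester n k \<epsilon> (junta_tester k \<epsilon> n)"
        unfolding distribution_free_junta_tester_def A
        using queries_within_tester tester_rejects_far[OF _ _ k 3(1) \<epsilon> 3(2)]
          tester_one_sided[unfolded one_sided_def] by fastforce
      then show ?thesis
        using tester_one_sided tester_cost[OF k \<epsilon> 3(2)] unfolding A by blast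
    qed
  qed
qed

end
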